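(* For every $\beta$ with $0<\beta<\frac12$ there exists a constant $C_\beta>0$ depending only on $\beta$ such that, for every $n\geq 1$, the free energy $F_{n,\beta}$ of the Sherrington-Kirkpatrick model satisfies $$\mathrm{Var}(F_{n,\beta})\leq \frac{C_\beta}{2\beta^2}.$$
   Context: In the Sherrington-Kirkpatrick (SK) model, $(X_{ij})_{1\leq i,j\leq n}$ are i.i.d. standard Gaussian random variables, the Hamiltonian is $$H_n(\sigma)=-\frac{1}{\sqrt n}\sum_{i,j=1}^nX_{ij}\sigma_i\sigma_j,\qquad \sigma\in\{-1,1\}^n,$$ and the free energy is $$F_{n,\beta}=\frac1\beta\log\Big(\sum_{\sigma\in\{-1,1\}^n}e^{\beta H_n(\sigma)}\Big),\qquad \beta>0.$$ (The alternative sign convention $-\frac1\beta\log\sum_\sigma e^{-\beta H_n(\sigma)}$ gives a random variable with the same variance, since $H_n$ is a centered Gaussian field.) *)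

theory Defs
  imports "HOL-Probability.Probability"
begin

definition sk_disorder :: "'a measure \<Rightarrow> nat \<Rightarrow> (nat \<Rightarrow> nat \<Rightarrow> 'a \<Rightarrow> real) \<Rightarrow> bool" where
  "sk_disorder M n X \<longleftrightarrow>
     prob_space M \<and>
     prob_space.indep_vars M (\<lambda>_. borel) (\<lambda>(i, j). X i j) ({1..n} \<times> {1..n}) \<and>
     (\<forall>i\<in>{1..n}. \<forall>j\<in>{1..n}. distributed M lborel (X i j) std_normal_density)"

(* Extensional functions, so that there are exactly 2 ^ n configurations and
   sums over them are finite. *)
definition spin_configs :: "nat \<Rightarrow> (nat \<Rightarrow> real) set" where
  "spin_configs n = {1..n} \<rightarrow>\<^sub>E {-1, 1}"

(* The argument x is a realization of the disorder matrix.  The sum ranges over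
   all ordered pairs, including the diagonal; no symmetry of x is imposed. *)
definition sk_hamiltonian :: "nat \<Rightarrow> (nat \<Rightarrow> nat \<Rightarrow> real) \<Rightarrow> (nat \<Rightarrow> real) \<Rightarrow> real" where
  "sk_hamiltonian n x \<sigma> =
     - (1 / sqrt (real n)) * (\<Sum>i=1..n. \<Sum>j=1..n. x i j * \<sigma> i * \<sigma> j)"

definition sk_free_energy :: "nat \<Rightarrow> real \<Rightarrow> (nat \<Rightarrow> nat \<Rightarrow> real) \<Rightarrow> real" where
  "sk_free_energy n \<beta> x =
     (1 / \<beta>) * ln (\<Sum>\<sigma>\<in>spin_configs n. exp (\<beta> * sk_hamiltonian n x \<sigma>))"

end

theory Submission
  imports Defs
begin

text \<open>
  Let \<open>Z\<close> be the partition function normalised to mean one and \<open>L = ln Z\<close>.  For \<open>\<beta> < 1 / 2\<close> both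
  \<open>Z\<^sup>2\<close> and \<open>Z\<^sup>2 |\<nabla>L|\<^sup>2\<close> have expectation bounded uniformly in \<open>n\<close>, so \<open>L \<ge> - ln 2\<close> and
  \<open>|\<nabla>L|\<^sup>2 \<le> K\<close> hold together with probability bounded below.  The upper tail of \<open>L\<close> is controlled
  by \<open>L \<le> Z\<close>.  For the lower tail, \<open>L\<close> is convex, hence lies above its tangents at the points of
  that good set; a smoothed maximum of finitely many of them is a globally Lipschitz minorant
  (up to an additive constant) which is not very negative with positive probability, and the
  Gaussian Poincare inequality bounds its variance by \<open>K\<close>, independently of the dimension.
\<close>

section \<open>The Gaussian Poincare inequality\<close>

text \<open>The Poincare inequality is useless on \<open>L\<close> itself: the pointwise bound on
  its squared gradient is \<open>\<beta>\<^sup>2 * n\<close>, and control of the expectation of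
  \<open>Z\<^sup>2 |\<nabla>L|\<^sup>2\<close> says little where \<open>Z\<close> is small. Cutting
  \<open>L\<close> off outside the good set would introduce new gradients; convexity avoids this,
  because a tangent keeps its slope on the whole space and stays below \<open>L\<close>. The
  variance is finally bounded by the raw second moment of \<open>L\<close>, which is affordable
  because the normalisation keeps \<open>L\<close> of order one.

  The threshold for \<beta> comes from the gradient moment. Let \<open>q\<close> be the covariance
  of the exponents of two configurations, that is \<open>\<beta>\<^sup>2 / n\<close> times their
  squared overlap. The second moment of \<open>Z\<close> averages \<open>exp q\<close> over pairs,
  the gradient moment averages \<open>q * exp q\<close>, and \<open>q \<le> exp q\<close> bounds
  both by the average of \<open>exp (2 * q)\<close>. For t < 1/2 the average of exp(t * overlap^2 /
  n) is bounded uniformly in n; here t is \<open>2 * \<beta>\<^sup>2\<close>, so the condition is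
  exactly \<beta> < 1/2.\<close>

definition std_gaussian :: "real measure" where
  "std_gaussian = density lborel (\<lambda>x. ennreal (std_normal_density x))"

lemma sets_std_gaussian [measurable_cong, simp]: "sets std_gaussian = sets borel"
  by (simp add: std_gaussian_def)

lemma space_std_gaussian [simp]: "space std_gaussian = UNIV"
  by (simp add: std_gaussian_def)

lemma prob_space_std_gaussian: "prob_space std_gaussian"
  unfolding std_gaussian_def using prob_space_normal_density[of 1 0] by simp

lemma integrable_std_gaussian_iff:
  fixes f :: "real \<Rightarrow> real"
  assumes [measurable]: "f \<in> borel_measurable borel"
  shows "integrable std_gaussian f \<longleftrightarrow> integrable lborel (\<lambda>x. std_normal_density x * f x)"
  unfolding std_gaussian_def by (subst integrable_density) auto

lemma integral_std_gaussian:
  fixes f :: "real \<Rightarrow> real"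
  assumes [measurable]: "f \<in> borel_measurable borel"
  shows "integral\<^sup>L std_gaussian f = (\<integral>x. std_normal_density x * f x \<partial>lborel)"
  unfolding std_gaussian_def by (subst integral_density) auto

lemma integrable_std_gaussian_power: "integrable std_gaussian (\<lambda>x. x ^ k)"
  by (subst integrable_std_gaussian_iff) (auto simp: integrable_std_normal_moment)

lemma integrable_std_gaussian_id: "integrable std_gaussian (\<lambda>x. x)"
  using integrable_std_gaussian_power[of 1] by simp

lemma integral_std_gaussian_id: "(\<integral>x. x \<partial>std_gaussian) = 0"
  using integral_std_normal_moment_odd[of 0] by (simp add: integral_std_gaussian)

section \<open>The Poincare inequality on the line\<close>

lemma has_real_derivative_std_normal_density:
  "(std_normal_density has_real_derivative - (x * std_normal_density x)) (at x)"
  unfolding std_normal_density_def[abs_def]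
  by (rule derivative_eq_intros refl | simp)+

lemma std_normal_density_at_top: "(std_normal_density \<longlongrightarrow> 0) at_top"
  unfolding std_normal_density_def[abs_def] by real_asymp

text \<open>The negated density is an antiderivative of \<open>x * std_normal_density x\<close>. The
  fundamental theorem is applied on \<open>{t..y}\<close> and y tends to infinity; the endpoint t,
  included in \<open>g\<close> but not in the statement, is a null set.\<close>

lemma integral_std_gaussian_upper_tail:
  "(\<integral>x. indicator {t<..} x * x \<partial>std_gaussian) = std_normal_density t"
proof -
  define g where "g = (\<lambda>x. indicator {t..} x * (std_normal_density x * x))"
  have int: "integrable lborel g"
    using integrable_real_mult_indicator[of "{t..}" lborel "\<lambda>x. std_normal_density x * x"]
      integrable_std_normal_moment[of 1] by (simp add: g_def mult.commute)
  have "((\<lambda>y. \<integral>x. indicator {..y} x *\<^sub>R g x \<partial>lborel) \<longlongrightarrow> (\<integral>x. g x \<partial>lborel)) at_top"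
    by (rule tendsto_integral_at_top) (use int in auto)
  moreover have "((\<lambda>y. \<integral>x. indicator {..y} x *\<^sub>R g x \<partial>lborel) \<longlongrightarrow> std_normal_density t - 0) at_top"
  proof (rule Lim_transform_eventually[OF tendsto_diff[OF tendsto_const std_normal_density_at_top]])
    show "\<forall>\<^sub>F y in at_top. std_normal_density t - std_normal_density y
        = (\<integral>x. indicator {..y} x *\<^sub>R g x \<partial>lborel)"
      using eventually_ge_at_top[of t]
    proof eventually_elim
      case (elim y)
      have "(\<integral>x. (x * std_normal_density x) * indicator {t..y} x \<partial>lborel)
          = (- std_normal_density y) - (- std_normal_density t)"
        using elim
        by (intro integral_FTC_Icc_real DERIV_cong[OF DERIV_minus[OF has_real_derivative_std_normal_density]])
          (auto simp: std_normal_density_def[abs_def] intro!: continuous_intros)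
      also have "(\<integral>x. (x * std_normal_density x) * indicator {t..y} x \<partial>lborel)
          = (\<integral>x. indicator {..y} x *\<^sub>R g x \<partial>lborel)"
        by (intro Bochner_Integration.integral_cong) (auto simp: g_def indicator_def)
      finally show ?case by simp
    qed
  qed
  ultimately have "(\<integral>x. g x \<partial>lborel) = std_normal_density t"
    using tendsto_unique[of at_top] by force
  moreover have "(\<integral>x. g x \<partial>lborel) = (\<integral>x. std_normal_density x * (indicator {t<..} x * x) \<partial>lborel)"
    using AE_lborel_singleton[of t] unfolding g_def
    by (intro integral_cong_AE) (auto elim!: eventually_mono simp: indicator_def)
  ultimately show ?thesis
    by (subst integral_std_gaussian) auto
qed

lemma integrable_indicator_std_gaussian [simp]:
  assumes "A \<in> sets borel"
  shows "integrable std_gaussian (\<lambda>x. indicator A x :: real)"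
    "integrable std_gaussian (\<lambda>x. indicator A x * x)"
proof -
  interpret prob_space std_gaussian by (rule prob_space_std_gaussian)
  show "integrable std_gaussian (\<lambda>x. indicator A x :: real)"
    using assms by (auto simp: integrable_indicator_iff emeasure_eq_measure)
  show "integrable std_gaussian (\<lambda>x. indicator A x * x)"
    using integrable_real_mult_indicator[OF _ integrable_std_gaussian_id, of A] assms
    by (simp add: mult.commute)
qed

lemma borel_measurable_indicator_rays [measurable]:
  fixes f g :: "'a \<Rightarrow> real"
  assumes [measurable]: "f \<in> borel_measurable M" "g \<in> borel_measurable M"
  shows "(\<lambda>z. indicator {f z<..} (g z) :: real) \<in> borel_measurable M"
    "(\<lambda>z. indicator {..f z} (g z) :: real) \<in> borel_measurable M"
  by (simp_all add: indicator_def)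

text \<open>The sharp constant in the Poincare inequality comes from this computation: the weight with
  which \<open>f' t ^ 2\<close> enters is exactly the Gaussian density.\<close>

lemma nn_integral_straddle_std_gaussian:
  "(\<integral>\<^sup>+x. (\<integral>\<^sup>+y. ennreal (indicator {t<..} x * indicator {..t} y * (x - y)) \<partial>std_gaussian) \<partial>std_gaussian)
     = ennreal (std_normal_density t)"
proof -
  interpret prob_space std_gaussian by (rule prob_space_std_gaussian)
  let ?P = "measure std_gaussian {..t}" and ?Q = "measure std_gaussian {t<..}"
  let ?b = "\<integral>y. indicator {..t} y * y \<partial>std_gaussian"
  have ind: "integrable std_gaussian (\<lambda>y. indicator {..t} y :: real)"
    "integrable std_gaussian (\<lambda>y. indicator {..t} y * y)"
    by simp_all
  have PQ: "?P + ?Q = 1"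
    using prob_compl[of "{..t}"] by (simp add: Compl_eq_Diff_UNIV[symmetric])
  \<comment> \<open>The mean is zero, so the first moment below t is minus the one above t.\<close>
  have "?b + (\<integral>x. indicator {t<..} x * x \<partial>std_gaussian)
     = (\<integral>x. indicator {..t} x * x + indicator {t<..} x * x \<partial>std_gaussian)"
    by (intro Bochner_Integration.integral_add[symmetric]) auto
  also have "\<dots> = (\<integral>x. x \<partial>std_gaussian)"
    by (intro Bochner_Integration.integral_cong) (auto simp: indicator_def)
  finally have b: "?b = - std_normal_density t"
    by (simp add: integral_std_gaussian_upper_tail integral_std_gaussian_id)
  have inner: "(\<integral>\<^sup>+y. ennreal (indicator {t<..} x * indicator {..t} y * (x - y)) \<partial>std_gaussian)
      = ennreal (indicator {t<..} x * (x * ?P + std_normal_density t))" for x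
  proof -
    have eq: "indicator {t<..} x * indicator {..t} y * (x - y)
      = indicator {t<..} x * (x * indicator {..t} y - indicator {..t} y * y)" for y :: real
      by (simp add: algebra_simps)
    have "(\<integral>\<^sup>+y. ennreal (indicator {t<..} x * indicator {..t} y * (x - y)) \<partial>std_gaussian)
      = ennreal (\<integral>y. indicator {t<..} x * (x * indicator {..t} y - indicator {..t} y * y) \<partial>std_gaussian)"
      unfolding eq
      by (intro nn_integral_eq_integral integrable_mult_right Bochner_Integration.integrable_diff ind)
        (auto simp: indicator_def)
    also have "(\<integral>y. indicator {t<..} x * (x * indicator {..t} y - indicator {..t} y * y) \<partial>std_gaussian)
      = indicator {t<..} x * (x * ?P + std_normal_density t)"
      by (simp add: b)
    finally show ?thesis .
  qed
  have nonneg: "0 \<le> indicator {t<..} x * (x * ?P + std_normal_density t)" for x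
  proof -
    have "0 \<le> (\<integral>y. indicator {..t} y * (x - y) \<partial>std_gaussian)" if "t < x"
      using that by (intro integral_nonneg_AE AE_I2) (auto simp: indicator_def)
    also have "(\<integral>y. indicator {..t} y * (x - y) \<partial>std_gaussian)
        = (\<integral>y. indicator {..t} y * x - indicator {..t} y * y \<partial>std_gaussian)"
      by (simp add: algebra_simps)
    also have "\<dots> = x * ?P + std_normal_density t"
      by (subst Bochner_Integration.integral_diff) (auto simp: b)
    finally show ?thesis by (auto simp: indicator_def)
  qed
  have "(\<integral>\<^sup>+x. ennreal (indicator {t<..} x * (x * ?P + std_normal_density t)) \<partial>std_gaussian)
     = ennreal (\<integral>x. indicator {t<..} x * (x * ?P + std_normal_density t) \<partial>std_gaussian)"
    by (intro nn_integral_eq_integral AE_I2 nonneg) (auto simp: ring_distribs mult.assoc[symmetric])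
  also have "(\<integral>x. indicator {t<..} x * (x * ?P + std_normal_density t) \<partial>std_gaussian)
     = (\<integral>x. (indicator {t<..} x * x) * ?P + indicator {t<..} x * std_normal_density t \<partial>std_gaussian)"
    by (simp add: algebra_simps)
  also have "\<dots> = std_normal_density t * ?P + ?Q * std_normal_density t"
    by (subst Bochner_Integration.integral_add) (auto simp: integral_std_gaussian_upper_tail)
  also have "\<dots> = std_normal_density t"
    using PQ by (metis mult.commute mult.right_neutral ring_class.ring_distribs(1))
  finally show ?thesis unfolding inner .
qed

text \<open>Cauchy-Schwarz for the increment written as an integral of \<open>f'\<close>, obtained
  by expanding the nonnegative integral of \<open>(f' t - m)\<^sup>2\<close> with \<open>m\<close>
  the mean slope. The two indicators say y \<le> t < x; this is the kernel whose Gaussian average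
  over x and y has already been computed.\<close>

lemma square_increment_le_integral_square_deriv:
  fixes f f' :: "real \<Rightarrow> real"
  assumes "\<And>t. (f has_real_derivative f' t) (at t)" "continuous_on UNIV f'" "y < x"
  shows "ennreal ((f x - f y)\<^sup>2)
    \<le> (\<integral>\<^sup>+t. ennreal (indicator {t<..} x * indicator {..t} y * (x - y) * (f' t)\<^sup>2) \<partial>lborel)"
proof -
  define m where "m = (f x - f y) / (x - y)"
  have cont: "isCont f' t" for t
    using assms(2) by (simp add: continuous_on_eq_continuous_at)
  have meas [measurable]: "f' \<in> borel_measurable borel"
    by (rule borel_measurable_continuous_onI) fact
  have i1: "has_bochner_integral lborel (\<lambda>t. f' t * indicator {y..x} t) (f x - f y)"
    using assms cont by (intro has_bochner_integral_FTC_Icc_real) auto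
  have i2: "integrable lborel (\<lambda>t. indicator {y..x} t *\<^sub>R (f' t)\<^sup>2)"
    by (intro borel_integrable_compact) (auto intro!: continuous_intros continuous_on_subset[OF assms(2)])
  have i3: "has_bochner_integral lborel (\<lambda>t. indicator {y..x} t :: real) (x - y)"
    using has_bochner_integral_FTC_Icc_real[of y x "\<lambda>t. t" "\<lambda>_. 1"] assms(3) by auto
  have "0 \<le> (\<integral>t. indicator {y..x} t *\<^sub>R (f' t - m)\<^sup>2 \<partial>lborel)"
    by (intro integral_nonneg_AE AE_I2) auto
  also have "\<dots> = (\<integral>t. indicator {y..x} t *\<^sub>R (f' t)\<^sup>2 - 2 * m * (f' t * indicator {y..x} t)
      + m\<^sup>2 * indicator {y..x} t \<partial>lborel)"
    by (intro Bochner_Integration.integral_cong) (auto simp: algebra_simps power2_eq_square indicator_def)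
  also have "\<dots> = (\<integral>t. indicator {y..x} t *\<^sub>R (f' t)\<^sup>2 \<partial>lborel) - 2 * m * (f x - f y) + m\<^sup>2 * (x - y)"
    using i1 i2 i3 by (simp add: has_bochner_integral_iff del: integral_indicator integrable_indicator_iff)
  also have fxy: "f x - f y = m * (x - y)"
    using assms(3) by (simp add: m_def)
  finally have "m\<^sup>2 * (x - y) \<le> (\<integral>t. indicator {y..x} t *\<^sub>R (f' t)\<^sup>2 \<partial>lborel)"
    by (simp add: power2_eq_square algebra_simps)
  hence "(x - y) * (m\<^sup>2 * (x - y)) \<le> (x - y) * (\<integral>t. indicator {y..x} t *\<^sub>R (f' t)\<^sup>2 \<partial>lborel)"
    using assms(3) by (intro mult_left_mono) auto
  also have "(x - y) * (m\<^sup>2 * (x - y)) = (f x - f y)\<^sup>2"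
    unfolding fxy by (simp add: power2_eq_square algebra_simps)
  finally have *: "(f x - f y)\<^sup>2 \<le> (\<integral>t. (x - y) * (indicator {y..x} t *\<^sub>R (f' t)\<^sup>2) \<partial>lborel)"
    by simp
  have "ennreal ((f x - f y)\<^sup>2) \<le> ennreal (\<integral>t. (x - y) * (indicator {y..x} t *\<^sub>R (f' t)\<^sup>2) \<partial>lborel)"
    using * by (rule ennreal_leI)
  also have "\<dots> = (\<integral>\<^sup>+t. ennreal ((x - y) * (indicator {y..x} t *\<^sub>R (f' t)\<^sup>2)) \<partial>lborel)"
    using assms(3) i2 by (intro nn_integral_eq_integral[symmetric]) auto
  also have "\<dots> = (\<integral>\<^sup>+t. ennreal (indicator {t<..} x * indicator {..t} y * (x - y) * (f' t)\<^sup>2) \<partial>lborel)"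
    using AE_lborel_singleton[of x]
    by (intro nn_integral_cong_AE) (auto elim!: eventually_mono simp: indicator_def)
  finally show ?thesis .
qed

text \<open>Symmetrisation: for independent copies X, Y the expectation of (f X - f Y)^2 is twice
  the variance. Each increment is bounded by an integral over t, and integrating out x and y first
  turns the kernel into the Gaussian density at t. The orderings y < x and x < y contribute one copy
  of the right-hand side each, which cancels the factor two.\<close>

lemma gaussian_poincare_1:
  fixes f f' :: "real \<Rightarrow> real"
  assumes f: "\<And>t. (f has_real_derivative f' t) (at t)" "continuous_on UNIV f'"
    and int: "integrable std_gaussian (\<lambda>x. (f x)\<^sup>2)" "integrable std_gaussian (\<lambda>x. (f' x)\<^sup>2)"
  shows "prob_space.variance std_gaussian f \<le> (\<integral>x. (f' x)\<^sup>2 \<partial>std_gaussian)"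
proof -
  interpret prob_space std_gaussian by (rule prob_space_std_gaussian)
  have meas [measurable]: "f' \<in> borel_measurable borel" "f \<in> borel_measurable borel"
    using f by (auto intro!: borel_measurable_continuous_onI DERIV_continuous_on)
  have int1: "integrable std_gaussian f"
    by (rule square_integrable_imp_integrable[OF _ int(1)]) simp
  interpret P: pair_prob_space std_gaussian std_gaussian ..
  interpret LG: pair_sigma_finite lborel std_gaussian ..
  let ?k = "\<lambda>x y t. ennreal (indicator {t<..} x * indicator {..t} y * (x - y) * (f' t)\<^sup>2)"
  have straddle: "(\<integral>\<^sup>+x. (\<integral>\<^sup>+y. (\<integral>\<^sup>+t. ?k x y t \<partial>lborel) \<partial>std_gaussian) \<partial>std_gaussian)
     = (\<integral>\<^sup>+t. ennreal ((f' t)\<^sup>2) \<partial>std_gaussian)"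
  proof -
    have "(\<integral>\<^sup>+x. (\<integral>\<^sup>+y. (\<integral>\<^sup>+t. ?k x y t \<partial>lborel) \<partial>std_gaussian) \<partial>std_gaussian)
       = (\<integral>\<^sup>+x. (\<integral>\<^sup>+t. (\<integral>\<^sup>+y. ?k x y t \<partial>std_gaussian) \<partial>lborel) \<partial>std_gaussian)"
      by (intro nn_integral_cong LG.Fubini') simp
    also have "\<dots> = (\<integral>\<^sup>+t. (\<integral>\<^sup>+x. (\<integral>\<^sup>+y. ?k x y t \<partial>std_gaussian) \<partial>std_gaussian) \<partial>lborel)"
      by (intro LG.Fubini') simp
    also have "\<dots> = (\<integral>\<^sup>+t. ennreal (std_normal_density t) * ennreal ((f' t)\<^sup>2) \<partial>lborel)"
    proof (rule nn_integral_cong)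
      fix t :: real
      have *: "ennreal (indicator {t<..} x * indicator {..t} y * (x - y) * (f' t)\<^sup>2)
          = ennreal (indicator {t<..} x * indicator {..t} y * (x - y)) * ennreal ((f' t)\<^sup>2)" for x y :: real
        by (intro ennreal_mult) (auto simp: indicator_def)
      show "(\<integral>\<^sup>+x. (\<integral>\<^sup>+y. ?k x y t \<partial>std_gaussian) \<partial>std_gaussian)
          = ennreal (std_normal_density t) * ennreal ((f' t)\<^sup>2)"
        unfolding * by (simp add: nn_integral_multc nn_integral_straddle_std_gaussian)
    qed
    also have "\<dots> = (\<integral>\<^sup>+t. ennreal ((f' t)\<^sup>2) \<partial>std_gaussian)"
      unfolding std_gaussian_def by (subst nn_integral_density) auto
    finally show ?thesis .
  qed
  \<comment> \<open>Only one of the two kernels bounds the increment, depending on the order of x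
    and y; the other is merely nonnegative, so their sum covers both cases.\<close>
  have pointwise: "ennreal ((f x - f y)\<^sup>2)
      \<le> (\<integral>\<^sup>+t. ?k x y t \<partial>lborel) + (\<integral>\<^sup>+t. ?k y x t \<partial>lborel)" for x y
  proof (cases x y rule: linorder_cases)
    case less
    have "ennreal ((f y - f x)\<^sup>2) \<le> (\<integral>\<^sup>+t. ?k y x t \<partial>lborel)"
      by (intro square_increment_le_integral_square_deriv f less)
    thus ?thesis by (simp add: power2_commute add_increasing)
  next
    case greater
    have "ennreal ((f x - f y)\<^sup>2) \<le> (\<integral>\<^sup>+t. ?k x y t \<partial>lborel)"
      by (intro square_increment_le_integral_square_deriv f greater)
    thus ?thesis by (simp add: add_increasing2)
  qed auto
  have "(\<integral>\<^sup>+x. (\<integral>\<^sup>+y. ennreal ((f x - f y)\<^sup>2) \<partial>std_gaussian) \<partial>std_gaussian)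
     \<le> (\<integral>\<^sup>+x. (\<integral>\<^sup>+y. (\<integral>\<^sup>+t. ?k x y t \<partial>lborel) + (\<integral>\<^sup>+t. ?k y x t \<partial>lborel) \<partial>std_gaussian) \<partial>std_gaussian)"
    by (intro nn_integral_mono pointwise)
  also have "\<dots> = (\<integral>\<^sup>+x. (\<integral>\<^sup>+y. (\<integral>\<^sup>+t. ?k x y t \<partial>lborel) \<partial>std_gaussian) \<partial>std_gaussian)
      + (\<integral>\<^sup>+x. (\<integral>\<^sup>+y. (\<integral>\<^sup>+t. ?k y x t \<partial>lborel) \<partial>std_gaussian) \<partial>std_gaussian)"
    by (simp add: nn_integral_add)
  also have "(\<integral>\<^sup>+x. (\<integral>\<^sup>+y. (\<integral>\<^sup>+t. ?k y x t \<partial>lborel) \<partial>std_gaussian) \<partial>std_gaussian)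
     = (\<integral>\<^sup>+x. (\<integral>\<^sup>+y. (\<integral>\<^sup>+t. ?k x y t \<partial>lborel) \<partial>std_gaussian) \<partial>std_gaussian)"
    by (intro P.Fubini') simp
  also have "(\<integral>\<^sup>+x. (\<integral>\<^sup>+y. (\<integral>\<^sup>+t. ?k x y t \<partial>lborel) \<partial>std_gaussian) \<partial>std_gaussian)
     = ennreal (\<integral>x. (f' x)\<^sup>2 \<partial>std_gaussian)"
    unfolding straddle by (intro nn_integral_eq_integral int) auto
  finally have le: "(\<integral>\<^sup>+x. (\<integral>\<^sup>+y. ennreal ((f x - f y)\<^sup>2) \<partial>std_gaussian) \<partial>std_gaussian)
     \<le> ennreal (2 * (\<integral>x. (f' x)\<^sup>2 \<partial>std_gaussian))"
    by (simp add: ennreal_plus[symmetric] del: ennreal_plus)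
  define e where "e = expectation f"
  define v where "v = expectation (\<lambda>x. (f x)\<^sup>2)"
  have inner: "(\<integral>\<^sup>+y. ennreal ((f x - f y)\<^sup>2) \<partial>std_gaussian) = ennreal ((f x)\<^sup>2 - 2 * e * f x + v)"
    and nonneg: "0 \<le> (f x)\<^sup>2 - 2 * e * f x + v" for x
  proof -
    have i: "integrable std_gaussian (\<lambda>y. (f x - f y)\<^sup>2)"
      by (simp add: power2_diff int int1)
    have e: "(\<integral>y. (f x - f y)\<^sup>2 \<partial>std_gaussian) = (f x)\<^sup>2 - 2 * e * f x + v"
      by (simp add: power2_diff int int1 prob_space e_def v_def prob_space[simplified])
    show "(\<integral>\<^sup>+y. ennreal ((f x - f y)\<^sup>2) \<partial>std_gaussian) = ennreal ((f x)\<^sup>2 - 2 * e * f x + v)"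
      unfolding e[symmetric] by (intro nn_integral_eq_integral i) auto
    show "0 \<le> (f x)\<^sup>2 - 2 * e * f x + v"
      unfolding e[symmetric] by simp
  qed
  have "(\<integral>\<^sup>+x. (\<integral>\<^sup>+y. ennreal ((f x - f y)\<^sup>2) \<partial>std_gaussian) \<partial>std_gaussian)
      = ennreal (\<integral>x. (f x)\<^sup>2 - 2 * e * f x + v \<partial>std_gaussian)"
    unfolding inner by (intro nn_integral_eq_integral AE_I2 nonneg) (simp add: int int1)
  also have "(\<integral>x. (f x)\<^sup>2 - 2 * e * f x + v \<partial>std_gaussian) = 2 * variance f"
  proof -
    have "(\<integral>x. (f x)\<^sup>2 - 2 * e * f x + v \<partial>std_gaussian) = v - 2 * e * e + v"
      by (simp add: int int1 prob_space[simplified] e_def v_def)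
    thus ?thesis
      using variance_eq[OF int1 int(1)] by (simp add: e_def v_def power2_eq_square[of "expectation f"])
  qed
  finally show ?thesis
    using le by (simp add: ennreal_le_iff)
qed

section \<open>Tensorisation of the variance and the inequality in several variables\<close>

lemma (in prob_space) square_expectation_le:
  fixes f :: "'a \<Rightarrow> real"
  assumes "integrable M f" "integrable M (\<lambda>x. (f x)\<^sup>2)"
  shows "(expectation f)\<^sup>2 \<le> expectation (\<lambda>x. (f x)\<^sup>2)"
  using variance_positive[of f] assms by (simp add: variance_eq)

lemma (in pair_prob_space) integrable_snd_comp:
  fixes g :: "'b \<Rightarrow> real"
  assumes "integrable M2 g"
  shows "integrable (M1 \<Otimes>\<^sub>M M2) (\<lambda>z. g (snd z))"
  using assms by (intro Fubini_integrable) auto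

text \<open>The variance splits into the mean of the variance in the second variable and the
  variance of the partial mean \<open>m\<close>. After centring, \<open>m\<close> is the average
  over the second variable of \<open>d\<close>, which is \<open>f\<close> minus its mean in the
  first variable; by Jensen its variance is at most the mean of \<open>d\<close> squared, which is
  the averaged variance in the first variable.\<close>

lemma (in pair_prob_space) variance_pair_le:
  fixes f h1 h2 :: "'a \<times> 'b \<Rightarrow> real"
  assumes [measurable]: "f \<in> borel_measurable (M1 \<Otimes>\<^sub>M M2)"
    and int: "integrable (M1 \<Otimes>\<^sub>M M2) (\<lambda>z. (f z)\<^sup>2)"
      "\<And>x. x \<in> space M1 \<Longrightarrow> integrable M2 (\<lambda>y. (f (x, y))\<^sup>2)"
      "\<And>y. y \<in> space M2 \<Longrightarrow> integrable M1 (\<lambda>x. (f (x, y))\<^sup>2)"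
    and h: "integrable (M1 \<Otimes>\<^sub>M M2) h1" "integrable (M1 \<Otimes>\<^sub>M M2) h2"
    and le1: "\<And>y. y \<in> space M2 \<Longrightarrow> M1.variance (\<lambda>x. f (x, y)) \<le> (\<integral>x. h1 (x, y) \<partial>M1)"
    and le2: "\<And>x. x \<in> space M1 \<Longrightarrow> M2.variance (\<lambda>y. f (x, y)) \<le> (\<integral>y. h2 (x, y) \<partial>M2)"
  shows "P.variance f \<le> P.expectation (\<lambda>z. h1 z + h2 z)"
proof -
  have f1: "integrable (M1 \<Otimes>\<^sub>M M2) f"
    by (rule P.square_integrable_imp_integrable[OF _ int(1)]) simp
  have sec2: "integrable M2 (\<lambda>y. f (x, y))" if "x \<in> space M1" for x
    by (rule M2.square_integrable_imp_integrable[OF _ int(2)]) (use that in auto)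
  have sec1: "integrable M1 (\<lambda>x. f (x, y))" if "y \<in> space M2" for y
    by (rule M1.square_integrable_imp_integrable[OF _ int(3)]) (use that in auto)
  define m where "m = (\<lambda>x. \<integral>y. f (x, y) \<partial>M2)"
  define r where "r = (\<lambda>y. \<integral>x. f (x, y) \<partial>M1)"
  define s where "s = (\<lambda>x. \<integral>y. (f (x, y))\<^sup>2 \<partial>M2)"
  define q where "q = (\<lambda>y. \<integral>x. (f (x, y))\<^sup>2 \<partial>M1)"
  have [measurable]: "m \<in> borel_measurable M1" "r \<in> borel_measurable M2"
    by (simp_all add: m_def r_def)
  have s: "integrable M1 s" unfolding s_def by (rule integrable_fst'[OF int(1)])
  have q: "integrable M2 q" unfolding q_def
    using integrable_snd[of "\<lambda>x y. (f (x, y))\<^sup>2"] int(1) by (simp add: case_prod_unfold)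
  have m1: "integrable M1 m" unfolding m_def by (rule integrable_fst'[OF f1])
  have m_le: "(m x)\<^sup>2 \<le> s x" if "x \<in> space M1" for x
    unfolding m_def s_def using sec2 int(2) that by (intro M2.square_expectation_le)
  have r_le: "(r y)\<^sup>2 \<le> q y" if "y \<in> space M2" for y
    unfolding r_def q_def using sec1 int(3) that by (intro M1.square_expectation_le)
  have m2: "integrable M1 (\<lambda>x. (m x)\<^sup>2)"
    by (rule Bochner_Integration.integrable_bound[OF s]) (use m_le in \<open>force intro!: AE_I2\<close>)+
  have r2: "integrable M2 (\<lambda>y. (r y)\<^sup>2)"
    by (rule Bochner_Integration.integrable_bound[OF q]) (use r_le in \<open>force intro!: AE_I2\<close>)+
  have r1: "integrable M2 r"
    by (rule M2.square_integrable_imp_integrable[OF _ r2]) simp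
  define d where "d = (\<lambda>z. f z - r (snd z))"
  have [measurable]: "d \<in> borel_measurable (M1 \<Otimes>\<^sub>M M2)" unfolding d_def by simp
  have d2: "integrable (M1 \<Otimes>\<^sub>M M2) (\<lambda>z. (d z)\<^sup>2)"
  proof (rule Bochner_Integration.integrable_bound)
    show "integrable (M1 \<Otimes>\<^sub>M M2) (\<lambda>z. 2 * (f z)\<^sup>2 + 2 * (r (snd z))\<^sup>2)"
      using int(1) integrable_snd_comp[OF r2] by simp
    have "(d z)\<^sup>2 \<le> 2 * (f z)\<^sup>2 + 2 * (r (snd z))\<^sup>2" for z
      using zero_le_power2[of "f z + r (snd z)"] by (simp add: d_def power2_eq_square algebra_simps)
    thus "AE z in M1 \<Otimes>\<^sub>M M2. norm ((d z)\<^sup>2) \<le> norm (2 * (f z)\<^sup>2 + 2 * (r (snd z))\<^sup>2)"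
      by (intro AE_I2) (auto intro: order_trans[OF _ abs_ge_self])
  qed simp
  have em: "M1.expectation m = P.expectation f"
    unfolding m_def by (rule integral_fst'[OF f1])
  have er: "M2.expectation r = P.expectation f"
    unfolding r_def using integral_snd[of "\<lambda>x y. f (x, y)"] f1 by (simp add: case_prod_unfold)

  have "P.variance f = P.expectation (\<lambda>z. (f z)\<^sup>2) - (P.expectation f)\<^sup>2"
    using f1 int(1) by (rule P.variance_eq)
  also have "P.expectation (\<lambda>z. (f z)\<^sup>2) = M1.expectation s"
    unfolding s_def by (rule integral_fst'[OF int(1), symmetric])
  also have "M1.expectation s = M1.expectation (\<lambda>x. s x - (m x)\<^sup>2) + M1.expectation (\<lambda>x. (m x)\<^sup>2)"
    using s m2 by simp
  also have "M1.expectation (\<lambda>x. (m x)\<^sup>2) = M1.variance m + (P.expectation f)\<^sup>2"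
    using M1.variance_eq[OF m1 m2] em by simp
  finally have "P.variance f = M1.expectation (\<lambda>x. s x - (m x)\<^sup>2) + M1.variance m" by simp
  also have "M1.expectation (\<lambda>x. s x - (m x)\<^sup>2) \<le> M1.expectation (\<lambda>x. \<integral>y. h2 (x, y) \<partial>M2)"
  proof (intro integral_mono_AE AE_I2)
    fix x assume x: "x \<in> space M1"
    show "s x - (m x)\<^sup>2 \<le> (\<integral>y. h2 (x, y) \<partial>M2)"
      using le2[OF x] by (subst (asm) M2.variance_eq) (auto simp: s_def m_def sec2 int(2) x)
  qed (use s m2 integrable_fst'[OF h(2)] in auto)
  also have "M1.expectation (\<lambda>x. \<integral>y. h2 (x, y) \<partial>M2) = P.expectation h2"
    by (rule integral_fst'[OF h(2)])
  also have "M1.variance m \<le> M1.expectation (\<lambda>x. \<integral>y. (d (x, y))\<^sup>2 \<partial>M2)"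
  proof (rule integral_mono_AE)
    show "AE x in M1. (m x - M1.expectation m)\<^sup>2 \<le> (\<integral>y. (d (x, y))\<^sup>2 \<partial>M2)"
      using AE_integrable_fst'[OF d2] AE_space
    proof eventually_elim
      case (elim x)
      have "m x - M1.expectation m = (\<integral>y. d (x, y) \<partial>M2)"
        unfolding d_def using sec2[OF elim(2)] r1 by (simp add: m_def em[unfolded m_def] er)
      thus ?case
        using M2.square_expectation_le[of "\<lambda>y. d (x, y)"] elim sec2[OF elim(2)] r1
        by (simp add: d_def)
    qed
  qed (use m1 m2 integrable_fst'[OF d2] in \<open>auto simp: power2_diff\<close>)
  also have "M1.expectation (\<lambda>x. \<integral>y. (d (x, y))\<^sup>2 \<partial>M2) = M2.expectation (\<lambda>y. \<integral>x. (d (x, y))\<^sup>2 \<partial>M1)"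
    using d2 by (intro Fubini_integral[symmetric]) (simp add: case_prod_unfold)
  also have "\<dots> \<le> M2.expectation (\<lambda>y. \<integral>x. h1 (x, y) \<partial>M1)"
  proof (rule integral_mono_AE)
    show "integrable M2 (\<lambda>y. \<integral>x. (d (x, y))\<^sup>2 \<partial>M1)" "integrable M2 (\<lambda>y. \<integral>x. h1 (x, y) \<partial>M1)"
      using integrable_snd[of "\<lambda>x y. h1 (x, y)"] integrable_snd[of "\<lambda>x y. (d (x, y))\<^sup>2"] h(1) d2
      by (simp_all add: case_prod_unfold)
    show "AE y in M2. (\<integral>x. (d (x, y))\<^sup>2 \<partial>M1) \<le> (\<integral>x. h1 (x, y) \<partial>M1)"
      using le1 by (intro AE_I2) (simp add: d_def r_def)
  qed
  also have "\<dots> = P.expectation h1"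
    using integral_snd[of "\<lambda>x y. h1 (x, y)"] h(1) by (simp add: case_prod_unfold)
  finally show ?thesis using h by simp
qed

abbreviation gaussian_vec :: "'i set \<Rightarrow> ('i \<Rightarrow> real) measure" where
  "gaussian_vec I \<equiv> PiM I (\<lambda>_. std_gaussian)"

lemma prob_space_gaussian_vec: "prob_space (gaussian_vec I)"
  by (intro prob_space_PiM prob_space_std_gaussian)

lemma integrable_component_square_gaussian_vec:
  assumes "i \<in> I"
  shows "integrable (gaussian_vec I) (\<lambda>x. (x i)\<^sup>2)"
proof -
  have "integrable (distr (gaussian_vec I) std_gaussian (\<lambda>x. x i)) (\<lambda>t. t\<^sup>2)"
    using assms by (subst distr_PiM_component) (auto intro: prob_space_std_gaussian integrable_std_gaussian_power)
  thus ?thesis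
    using assms by (subst (asm) integrable_distr_eq) auto
qed

lemma integrable_square_linear_growth:
  assumes "finite I" and [measurable]: "f \<in> borel_measurable (gaussian_vec I)"
    and growth: "\<And>x. \<bar>f x\<bar> \<le> A + B * (\<Sum>i\<in>I. \<bar>x i\<bar>)"
  shows "integrable (gaussian_vec I) (\<lambda>x. (f x)\<^sup>2)"
proof -
  interpret prob_space "gaussian_vec I" by (rule prob_space_gaussian_vec)
  have "(f x)\<^sup>2 \<le> 2 * A\<^sup>2 + 2 * B\<^sup>2 * (real (card I) * (\<Sum>i\<in>I. (x i)\<^sup>2))" for x
  proof -
    have "(f x)\<^sup>2 \<le> (A + B * (\<Sum>i\<in>I. \<bar>x i\<bar>))\<^sup>2"
      using power_mono[OF growth[of x] abs_ge_zero, of 2] by simp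
    also have "\<dots> \<le> 2 * A\<^sup>2 + 2 * B\<^sup>2 * (\<Sum>i\<in>I. \<bar>x i\<bar>)\<^sup>2"
      using zero_le_power2[of "A - B * (\<Sum>i\<in>I. \<bar>x i\<bar>)"] by (simp add: power2_eq_square algebra_simps)
    also have "(\<Sum>i\<in>I. \<bar>x i\<bar>)\<^sup>2 \<le> real (card I) * (\<Sum>i\<in>I. (x i)\<^sup>2)"
      using Cauchy_Schwarz_ineq_sum[of "\<lambda>_. 1" "\<lambda>i. \<bar>x i\<bar>" I] by simp
    finally show ?thesis by (simp add: mult_left_mono)
  qed
  hence "AE x in gaussian_vec I. norm ((f x)\<^sup>2) \<le> norm (2 * A\<^sup>2 + 2 * B\<^sup>2 * (card I * (\<Sum>i\<in>I. (x i)\<^sup>2)))"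
    by (intro AE_I2) (auto intro: order_trans[OF _ abs_ge_self])
  thus ?thesis
    by (rule Bochner_Integration.integrable_bound[rotated 2])
      (auto intro!: Bochner_Integration.integrable_add integrable_mult_right
        Bochner_Integration.integrable_sum integrable_component_square_gaussian_vec)
qed

text \<open>Induction on the coordinates by tensorisation. Linear growth provides square
  integrability of \<open>f\<close> and of every section, and it survives the induction: freezing
  coordinate i at t only replaces \<open>A\<close> by \<open>A + B * \<bar>t\<bar>\<close>. This is
  why \<open>A\<close> is generalised while \<open>B\<close> stays fixed.\<close>

theorem gaussian_poincare:
  fixes f :: "('i \<Rightarrow> real) \<Rightarrow> real" and g :: "'i \<Rightarrow> ('i \<Rightarrow> real) \<Rightarrow> real"
  assumes "finite I" "f \<in> borel_measurable (gaussian_vec I)"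
    and "\<And>i. i \<in> I \<Longrightarrow> g i \<in> borel_measurable (gaussian_vec I)"
    and "\<And>i x t. i \<in> I \<Longrightarrow> ((\<lambda>s. f (x(i := s))) has_real_derivative g i (x(i := t))) (at t)"
    and "\<And>i x. i \<in> I \<Longrightarrow> continuous_on UNIV (\<lambda>t. g i (x(i := t)))"
    and "\<And>i x. i \<in> I \<Longrightarrow> \<bar>g i x\<bar> \<le> B"
    and "\<And>x. \<bar>f x\<bar> \<le> A + B * (\<Sum>i\<in>I. \<bar>x i\<bar>)"
  shows "prob_space.variance (gaussian_vec I) f \<le> (\<integral>x. (\<Sum>i\<in>I. (g i x)\<^sup>2) \<partial>gaussian_vec I)"
  using assms
proof (induction I arbitrary: f g A rule: finite_induct)
  case empty
  interpret prob_space "gaussian_vec ({} :: 'i set)" by (rule prob_space_gaussian_vec)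
  \<comment> \<open>The empty product space has a single point, so the variance is zero.\<close>
  have const: "f x = f (\<lambda>_. undefined)" if "x \<in> space (gaussian_vec ({} :: 'i set))" for x
    using that by (simp add: space_PiM)
  have "expectation f = expectation (\<lambda>_. f (\<lambda>_. undefined))"
    by (rule Bochner_Integration.integral_cong[OF refl const])
  hence "expectation f = f (\<lambda>_. undefined)" by (simp add: prob_space)
  hence "variance f = expectation (\<lambda>_. 0)"
    by (intro Bochner_Integration.integral_cong[OF refl]) (metis const diff_self zero_power2)
  thus ?case by simp
next
  case (insert i I)
  note [measurable] = insert.prems(1,2)
  note deriv = insert.prems(3) and cont = insert.prems(4) and bound = insert.prems(5)
    and growth = insert.prems(6)
  interpret G: prob_space std_gaussian by (rule prob_space_std_gaussian)
  interpret V: prob_space "gaussian_vec I" by (rule prob_space_gaussian_vec)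
  interpret N: pair_prob_space std_gaussian "gaussian_vec I" ..
  let ?T = "\<lambda>(t, x). x(i := t)"
  have T [measurable]: "?T \<in> std_gaussian \<Otimes>\<^sub>M gaussian_vec I \<rightarrow>\<^sub>M gaussian_vec (insert i I)"
    by (simp add: case_prod_unfold measurable_fun_upd[where J = I])
  have T1 [measurable]: "(\<lambda>t. x(i := t)) \<in> std_gaussian \<rightarrow>\<^sub>M gaussian_vec (insert i I)"
    if "x \<in> space (gaussian_vec I)" for x
    using measurable_compose[OF measurable_Pair2'[OF that] T] by simp
  have T2 [measurable]: "(\<lambda>x. x(i := t)) \<in> gaussian_vec I \<rightarrow>\<^sub>M gaussian_vec (insert i I)" for t
    by (rule measurable_fun_upd[where J = I]) auto
  have distr: "gaussian_vec (insert i I) = distr (std_gaussian \<Otimes>\<^sub>M gaussian_vec I) (gaussian_vec (insert i I)) ?T"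
    by (rule distr_pair_PiM_eq_PiM[symmetric]) (auto intro: prob_space_std_gaussian)
  have gm [measurable]: "g j \<in> borel_measurable (gaussian_vec (insert i I))" if "j \<in> insert i I" for j
    using insert.prems(2) that by simp
  have f2: "integrable (gaussian_vec (insert i I)) (\<lambda>x. (f x)\<^sup>2)"
    by (rule integrable_square_linear_growth[OF _ _ growth]) (use insert.hyps in auto)
  \<comment> \<open>Stated for any probability space mapped into the product, because it is applied
    both on the pair space and on one-dimensional sections.\<close>
  have g2: "integrable M (\<lambda>z. (g j (h z))\<^sup>2)"
    if "prob_space M" "h \<in> M \<rightarrow>\<^sub>M gaussian_vec (insert i I)" "j \<in> insert i I"
    for M :: "'z measure" and h j
  proof -
    interpret M: prob_space M by fact
    note [measurable] = that(2)
    show ?thesis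
      using that(3) power_mono[OF bound abs_ge_zero, of j _ 2]
      by (intro M.integrable_const_bound[where B = "B\<^sup>2"] AE_I2) auto
  qed
  have growth_sec: "\<bar>f (x(i := t))\<bar> \<le> (A + B * \<bar>t\<bar>) + B * (\<Sum>j\<in>I. \<bar>x j\<bar>)" for x t
  proof -
    have eq: "(\<Sum>j\<in>insert i I. \<bar>(x(i := t)) j\<bar>) = \<bar>t\<bar> + (\<Sum>j\<in>I. \<bar>x j\<bar>)"
      using insert.hyps by (simp, intro sum.cong) auto
    have "\<bar>f (x(i := t))\<bar> \<le> A + B * (\<bar>t\<bar> + (\<Sum>j\<in>I. \<bar>x j\<bar>))"
      using growth[of "x(i := t)"] unfolding eq .
    thus ?thesis by (simp only: distrib_left add.assoc)
  qed
  have F2: "integrable (gaussian_vec I) (\<lambda>x. (f (x(i := t)))\<^sup>2)" for t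
    by (rule integrable_square_linear_growth[OF _ _ growth_sec]) (use insert.hyps in auto)
  have F1: "integrable std_gaussian (\<lambda>t. (f (x(i := t)))\<^sup>2)" if "x \<in> space (gaussian_vec I)" for x
  proof -
    note [measurable] = T1[OF that]
    define D where "D = A + B * (\<Sum>j\<in>I. \<bar>x j\<bar>)"
    have "(f (x(i := t)))\<^sup>2 \<le> 2 * D\<^sup>2 + 2 * B\<^sup>2 * t\<^sup>2" for t
    proof -
      have "\<bar>f (x(i := t))\<bar> \<le> D + B * \<bar>t\<bar>"
        using growth_sec[of x t] by (simp add: D_def)
      hence "(f (x(i := t)))\<^sup>2 \<le> (D + B * \<bar>t\<bar>)\<^sup>2"
        using power_mono[of "\<bar>f (x(i := t))\<bar>" "D + B * \<bar>t\<bar>" 2] by simp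
      also have "\<dots> \<le> 2 * D\<^sup>2 + 2 * B\<^sup>2 * \<bar>t\<bar>\<^sup>2"
        using zero_le_power2[of "D - B * \<bar>t\<bar>"] by (simp add: power2_eq_square algebra_simps)
      finally show ?thesis by simp
    qed
    hence "AE t in std_gaussian. norm ((f (x(i := t)))\<^sup>2) \<le> norm (2 * D\<^sup>2 + 2 * B\<^sup>2 * t\<^sup>2)"
      by (intro AE_I2) (auto intro: order_trans[OF _ abs_ge_self])
    thus ?thesis
      by (rule Bochner_Integration.integrable_bound[rotated 2])
        (auto intro!: Bochner_Integration.integrable_add integrable_mult_right integrable_std_gaussian_power)
  qed
  have "prob_space.variance (gaussian_vec (insert i I)) f = N.P.variance (\<lambda>z. f (?T z))"
    by (subst (1 2) distr) (simp add: integral_distr)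
  also have "\<dots> \<le> N.P.expectation (\<lambda>z. (g i (?T z))\<^sup>2 + (\<Sum>j\<in>I. (g j (?T z))\<^sup>2))"
  proof (rule N.variance_pair_le)
    show "integrable (std_gaussian \<Otimes>\<^sub>M gaussian_vec I) (\<lambda>z. (f (?T z))\<^sup>2)"
      using f2 by (subst (asm) distr, subst (asm) integrable_distr_eq) auto
    show "integrable (gaussian_vec I) (\<lambda>y. (f (?T (x, y)))\<^sup>2)" for x
      using F2 by simp
    show "integrable std_gaussian (\<lambda>x. (f (?T (x, y)))\<^sup>2)" if "y \<in> space (gaussian_vec I)" for y
      using F1[OF that] by simp
    show "integrable (std_gaussian \<Otimes>\<^sub>M gaussian_vec I) (\<lambda>z. (g i (?T z))\<^sup>2)"
      by (rule g2) (auto intro: N.P.prob_space_axioms)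
    show "integrable (std_gaussian \<Otimes>\<^sub>M gaussian_vec I) (\<lambda>z. \<Sum>j\<in>I. (g j (?T z))\<^sup>2)"
      by (intro Bochner_Integration.integrable_sum g2) (auto intro: N.P.prob_space_axioms)
    show "G.variance (\<lambda>t. f (?T (t, x))) \<le> G.expectation (\<lambda>t. (g i (?T (t, x)))\<^sup>2)"
      if x: "x \<in> space (gaussian_vec I)" for x
      using gaussian_poincare_1[of "\<lambda>t. f (x(i := t))" "\<lambda>t. g i (x(i := t))",
        OF deriv cont F1[OF x] g2[OF G.prob_space_axioms T1[OF x]]] by simp
    show "V.variance (\<lambda>x. f (?T (t, x))) \<le> V.expectation (\<lambda>x. \<Sum>j\<in>I. (g j (?T (t, x)))\<^sup>2)" for t
      unfolding prod.case
    proof (rule insert.IH)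
      fix j x s assume j: "j \<in> I"
      hence ji: "j \<noteq> i" using insert.hyps by auto
      show "((\<lambda>s. f ((x(j := s))(i := t))) has_real_derivative g j ((x(j := s))(i := t))) (at s)"
        unfolding fun_upd_twist[OF ji] by (rule deriv) (use j in simp)
      show "continuous_on UNIV (\<lambda>s. g j ((x(j := s))(i := t)))"
        unfolding fun_upd_twist[OF ji] by (rule cont) (use j in simp)
    next
      show "(\<lambda>x. f (x(i := t))) \<in> borel_measurable (gaussian_vec I)"
        using measurable_compose[OF T2 insert.prems(1)] .
      show "(\<lambda>x. g j (x(i := t))) \<in> borel_measurable (gaussian_vec I)" if "j \<in> I" for j
        using measurable_compose[OF T2 gm] that by blast
      show "\<bar>g j (x(i := t))\<bar> \<le> B" if "j \<in> I" for j x
        using bound that by blast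
      show "\<bar>f (x(i := t))\<bar> \<le> (A + B * \<bar>t\<bar>) + B * (\<Sum>j\<in>I. \<bar>x j\<bar>)" for x
        by (rule growth_sec)
    qed
  qed simp
  also have "\<dots> = (\<integral>x. (\<Sum>j\<in>insert i I. (g j x)\<^sup>2) \<partial>gaussian_vec (insert i I))"
    using insert.hyps by (subst distr, subst integral_distr) auto
  finally show ?case .
qed

section \<open>Logarithms of exponential sums of a Gaussian vector\<close>

text \<open>Chebyshev read backwards: if the mean lay further than \<open>sqrt (K / p)\<close> below
  r, then exceeding r would be a deviation of probability less than p. A merely positive probability
  thus locates the mean, with no reference to the dimension.\<close>

lemma (in prob_space) expectation_ge_of_variance_le:
  assumes [measurable]: "f \<in> borel_measurable M"
    and int: "integrable M (\<lambda>x. (f x)\<^sup>2)" and var: "variance f \<le> K"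
    and p: "0 < p" "p < prob {x \<in> space M. r < f x}"
  shows "r - sqrt (K / p) \<le> expectation f"
proof (rule ccontr)
  assume "\<not> ?thesis"
  hence less: "sqrt (K / p) < r - expectation f" by simp
  have "0 \<le> K" using variance_positive[of f] var by linarith
  define t where "t = r - expectation f"
  have "0 \<le> sqrt (K / p)" using \<open>0 \<le> K\<close> p by simp
  hence t: "0 < t" using less unfolding t_def by linarith
  have f1: "integrable M f" by (rule square_integrable_imp_integrable[OF _ int]) simp
  have "p < prob {x \<in> space M. r < f x}" by fact
  also have "\<dots> \<le> prob {x \<in> space M. \<bar>f x - expectation f\<bar> \<ge> t}"
    by (intro finite_measure_mono) (auto simp: t_def)
  also have "\<dots> \<le> variance f / t\<^sup>2"
    by (rule Chebyshev_inequality[OF _ int t]) simp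
  also have "\<dots> \<le> K / t\<^sup>2" using var by (intro divide_right_mono) auto
  finally have "t\<^sup>2 < K / p" using p t by (simp add: field_simps)
  hence "t < sqrt (K / p)" by (rule real_less_rsqrt)
  thus False using less by (simp add: t_def)
qed

section \<open>Gaussian exponential moments\<close>

lemma
  fixes s :: real
  shows integrable_exp_std_gaussian: "integrable std_gaussian (\<lambda>x. exp (s * x))"
    and integral_exp_std_gaussian: "(\<integral>x. exp (s * x) \<partial>std_gaussian) = exp (s\<^sup>2 / 2)"
proof -
  \<comment> \<open>Completing the square: the exponential tilt moves the mean to s.\<close>
  have eq: "std_normal_density x * exp (s * x) = exp (s\<^sup>2 / 2) * normal_density s 1 x" for x
    by (simp add: normal_density_def mult_exp_exp) (simp add: power2_eq_square field_simps)
  show "integrable std_gaussian (\<lambda>x. exp (s * x))"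
    by (subst integrable_std_gaussian_iff) (simp_all add: eq)
  show "(\<integral>x. exp (s * x) \<partial>std_gaussian) = exp (s\<^sup>2 / 2)"
    by (subst integral_std_gaussian) (simp_all add: eq)
qed

lemma
  fixes t :: real
  assumes "t < 1 / 2"
  shows integrable_exp_square_std_gaussian: "integrable std_gaussian (\<lambda>x. exp (t * x\<^sup>2))"
    and integral_exp_square_std_gaussian: "(\<integral>x. exp (t * x\<^sup>2) \<partial>std_gaussian) = 1 / sqrt (1 - 2 * t)"
proof -
  \<comment> \<open>The quadratic tilt leaves a centred Gaussian whose standard deviation is
    \<open>r\<close>; t < 1/2 keeps the quadratic form negative definite.\<close>
  define r where "r = 1 / sqrt (1 - 2 * t)"
  have r: "r > 0" using assms by (simp add: r_def)
  have r2: "1 / r\<^sup>2 = 1 - 2 * t" using assms by (simp add: r_def power_divide)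
  have eq: "std_normal_density x * exp (t * x\<^sup>2) = r * normal_density 0 r x" for x
  proof -
    have "- x\<^sup>2 / 2 + t * x\<^sup>2 = - (1 / r\<^sup>2) * x\<^sup>2 / 2" unfolding r2 by (simp add: field_simps)
    also have "\<dots> = - (x - 0)\<^sup>2 / (2 * r\<^sup>2)" by simp
    finally have "exp (- x\<^sup>2 / 2) * exp (t * x\<^sup>2) = exp (- (x - 0)\<^sup>2 / (2 * r\<^sup>2))"
      by (simp add: mult_exp_exp)
    thus ?thesis using r by (simp add: normal_density_def real_sqrt_mult)
  qed
  show "integrable std_gaussian (\<lambda>x. exp (t * x\<^sup>2))"
    using r by (subst integrable_std_gaussian_iff) (simp_all add: eq)
  show "(\<integral>x. exp (t * x\<^sup>2) \<partial>std_gaussian) = 1 / sqrt (1 - 2 * t)"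
    using r by (subst integral_std_gaussian) (simp_all add: eq r_def[symmetric])
qed

lemma
  fixes s :: "'i \<Rightarrow> real"
  assumes "finite I"
  shows integrable_exp_gaussian_vec: "integrable (gaussian_vec I) (\<lambda>x. exp (\<Sum>i\<in>I. s i * x i))"
    and integral_exp_gaussian_vec:
      "(\<integral>x. exp (\<Sum>i\<in>I. s i * x i) \<partial>gaussian_vec I) = exp ((\<Sum>i\<in>I. (s i)\<^sup>2) / 2)"
proof -
  interpret prob_space std_gaussian by (rule prob_space_std_gaussian)
  interpret product_sigma_finite "\<lambda>_::'i. std_gaussian" ..
  show "integrable (gaussian_vec I) (\<lambda>x. exp (\<Sum>i\<in>I. s i * x i))"
    using assms unfolding exp_sum[OF assms]
    by (intro product_integrable_prod integrable_exp_std_gaussian)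
  show "(\<integral>x. exp (\<Sum>i\<in>I. s i * x i) \<partial>gaussian_vec I) = exp ((\<Sum>i\<in>I. (s i)\<^sup>2) / 2)"
    unfolding exp_sum[OF assms] sum_divide_distrib
    by (subst product_integral_prod[OF assms integrable_exp_std_gaussian])
      (simp add: integral_exp_std_gaussian)
qed

section \<open>Log-sum-exp functions: convexity, gradient and moments\<close>

text \<open>Kept abstract because it is instantiated twice: for the partition function, with
  \<open>c\<close> the normalisation, and for the smoothed maximum of tangents, with
  \<open>c\<close> their offsets. Countability of the index type makes the function space second
  countable, as Lindelof's theorem demands.\<close>

locale log_sum_exp =
  fixes I :: "'i :: countable set" and F :: "'b set" and c :: "'b \<Rightarrow> real" and v :: "'b \<Rightarrow> 'i \<Rightarrow> real"
  assumes finite_I: "finite I" and finite_F: "finite F" and F_nonempty: "F \<noteq> {}"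
begin

definition lin :: "'b \<Rightarrow> ('i \<Rightarrow> real) \<Rightarrow> real" where
  "lin a x = c a + (\<Sum>i\<in>I. v a i * x i)"

definition Z :: "('i \<Rightarrow> real) \<Rightarrow> real" where
  "Z x = (\<Sum>a\<in>F. exp (lin a x))"

definition L :: "('i \<Rightarrow> real) \<Rightarrow> real" where
  "L x = ln (Z x)"

definition grad :: "'i \<Rightarrow> ('i \<Rightarrow> real) \<Rightarrow> real" where
  "grad i x = (\<Sum>a\<in>F. exp (lin a x) * v a i) / Z x"

definition grad_sq :: "('i \<Rightarrow> real) \<Rightarrow> real" where
  "grad_sq x = (\<Sum>i\<in>I. (grad i x)\<^sup>2)"

lemma Z_pos: "0 < Z x"
  unfolding Z_def using finite_F F_nonempty by (intro sum_pos) auto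

lemma measurable_lin [measurable]: "lin a \<in> borel_measurable (gaussian_vec I)"
  unfolding lin_def[abs_def] by measurable

lemma measurable_Z [measurable]: "Z \<in> borel_measurable (gaussian_vec I)"
  unfolding Z_def[abs_def] by measurable

lemma measurable_L [measurable]: "L \<in> borel_measurable (gaussian_vec I)"
  unfolding L_def[abs_def] by measurable

lemma measurable_grad [measurable]: "grad i \<in> borel_measurable (gaussian_vec I)"
  unfolding grad_def[abs_def] by measurable

lemma measurable_grad_sq [measurable]: "grad_sq \<in> borel_measurable (gaussian_vec I)"
  unfolding grad_sq_def[abs_def] by measurable

lemma lin_diff: "lin a x - lin a y = (\<Sum>i\<in>I. v a i * (x i - y i))"
  by (simp add: lin_def sum_subtractf[symmetric] right_diff_distrib)

text \<open>Jensen for the Gibbs measure at y: \<open>Z x / Z y\<close> is the Gibbs average of the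
  exponentials of \<open>lin a x - lin a y\<close>, and \<open>m\<close> is the Gibbs average of
  these exponents. The tangent of exp at \<open>m\<close> lies below exp, and its linear part
  averages to zero.\<close>

lemma L_ge_tangent: "L y + (\<Sum>i\<in>I. grad i y * (x i - y i)) \<le> L x"
proof -
  define m where "m = (\<Sum>i\<in>I. grad i y * (x i - y i))"
  have m: "(\<Sum>a\<in>F. exp (lin a y) * (lin a x - lin a y)) = m * Z y"
  proof -
    have "(\<Sum>a\<in>F. exp (lin a y) * (lin a x - lin a y))
        = (\<Sum>i\<in>I. \<Sum>a\<in>F. exp (lin a y) * v a i * (x i - y i))"
      unfolding lin_diff sum_distrib_left by (subst sum.swap) (simp add: mult.assoc)
    also have "\<dots> = m * Z y"
      unfolding m_def sum_distrib_right[of _ I] grad_def using Z_pos[of y]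
      by (intro sum.cong refl) (simp add: sum_distrib_right[symmetric])
    finally show ?thesis .
  qed
  have "exp m * Z y = exp m * (\<Sum>a\<in>F. exp (lin a y) * (1 + (lin a x - lin a y - m)))"
    by (simp add: ring_distribs sum.distrib sum_subtractf m[unfolded ring_distribs sum_subtractf]
        sum_distrib_right[symmetric] Z_def[symmetric])
  also have "\<dots> \<le> exp m * (\<Sum>a\<in>F. exp (lin a y) * exp (lin a x - lin a y - m))"
    by (intro mult_left_mono sum_mono) (auto intro: exp_ge_add_one_self)
  also have "\<dots> = Z x"
    by (simp add: Z_def sum_distrib_left mult_exp_exp)
  finally have "ln (exp m * Z y) \<le> ln (Z x)"
    using Z_pos by (subst ln_le_cancel_iff) auto
  thus ?thesis using Z_pos[of y] by (simp add: L_def m_def ln_mult add.commute)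
qed

lemma grad_sq_nonneg: "0 \<le> grad_sq x"
  by (simp add: grad_sq_def sum_nonneg)

lemma Z_square: "(Z x)\<^sup>2 = (\<Sum>a\<in>F. \<Sum>b\<in>F. exp (lin a x + lin b x))"
  by (simp add: Z_def power2_eq_square sum_product exp_add)

text \<open>The gradient is a Gibbs average, so multiplying by \<open>(Z x)\<^sup>2\<close> clears
  its denominators. What remains is a double sum over two replicas whose expectation only needs
  Gaussian exponential moments.\<close>

lemma Z_square_grad_sq:
  "(Z x)\<^sup>2 * grad_sq x = (\<Sum>a\<in>F. \<Sum>b\<in>F. exp (lin a x + lin b x) * (\<Sum>i\<in>I. v a i * v b i))"
proof -
  have "(Z x)\<^sup>2 * grad_sq x = (\<Sum>i\<in>I. (\<Sum>a\<in>F. exp (lin a x) * v a i)\<^sup>2)"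
    using Z_pos[of x] by (simp add: grad_sq_def grad_def power_divide sum_divide_distrib[symmetric])
  also have "\<dots> = (\<Sum>i\<in>I. \<Sum>a\<in>F. \<Sum>b\<in>F. exp (lin a x + lin b x) * (v a i * v b i))"
    by (simp add: power2_eq_square sum_product exp_add mult_ac)
  also have "\<dots> = (\<Sum>a\<in>F. \<Sum>b\<in>F. \<Sum>i\<in>I. exp (lin a x + lin b x) * (v a i * v b i))"
    by (subst sum.swap, intro sum.cong refl, rule sum.swap)
  finally show ?thesis by (simp add: sum_distrib_left)
qed

text \<open>The gradient is a convex combination of the vectors \<open>v a\<close>, hence no longer
  than the longest of them; the replica sum and 2uv \<le> u^2 + v^2 give this directly.\<close>

lemma grad_sq_le:
  assumes "\<And>a. a \<in> F \<Longrightarrow> (\<Sum>i\<in>I. (v a i)\<^sup>2) \<le> K"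
  shows "grad_sq x \<le> K"
proof -
  have cs: "(\<Sum>i\<in>I. v a i * v b i) \<le> K" if "a \<in> F" "b \<in> F" for a b
  proof -
    have "2 * (\<Sum>i\<in>I. v a i * v b i) \<le> (\<Sum>i\<in>I. (v a i)\<^sup>2 + (v b i)\<^sup>2)"
      unfolding sum_distrib_left
      by (intro sum_mono) (use sum_squares_bound in \<open>auto simp: mult.assoc\<close>)
    also have "\<dots> \<le> K + K"
      unfolding sum.distrib using assms that by (intro add_mono) auto
    finally show ?thesis by simp
  qed
  have "(Z x)\<^sup>2 * grad_sq x \<le> (\<Sum>a\<in>F. \<Sum>b\<in>F. exp (lin a x + lin b x) * K)"
    unfolding Z_square_grad_sq by (intro sum_mono mult_left_mono cs) auto
  also have "\<dots> = (Z x)\<^sup>2 * K"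
    by (simp add: Z_square sum_distrib_right)
  finally show ?thesis using Z_pos[of x] by simp
qed

lemma has_real_derivative_L:
  assumes "i \<in> I"
  shows "((\<lambda>s. L (x(i := s))) has_real_derivative grad i (x(i := t))) (at t)"
proof -
  have lin: "lin a (x(i := s)) = lin a (x(i := 0)) + v a i * s" for a s
    using assms finite_I by (simp add: lin_def sum.remove[of I i])
  have "((\<lambda>s. \<Sum>a\<in>F. exp (lin a (x(i := 0)) + v a i * s)) has_real_derivative
      (\<Sum>a\<in>F. exp (lin a (x(i := 0)) + v a i * t) * v a i)) (at t)"
    by (auto intro!: derivative_eq_intros)
  moreover have "(\<Sum>a\<in>F. exp (lin a (x(i := 0)) + v a i * t)) > 0"
    using Z_pos[of "x(i := t)"] unfolding Z_def lin[of _ t] .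
  ultimately show ?thesis
    unfolding L_def grad_def Z_def by (subst (1 2 3) lin) (auto intro!: derivative_eq_intros)
qed

lemma continuous_on_grad:
  assumes "i \<in> I"
  shows "continuous_on UNIV (\<lambda>s. grad j (x(i := s)))"
proof -
  have "continuous_on UNIV (\<lambda>s. (x(i := s)) k)" for k
    by (cases "k = i") (auto intro: continuous_intros)
  hence "continuous_on UNIV (\<lambda>s. lin a (x(i := s)))" for a
    unfolding lin_def by (intro continuous_intros)
  thus ?thesis
    unfolding grad_def using Z_pos
    by (intro continuous_intros) (auto simp: Z_def less_imp_neq[THEN not_sym] intro!: continuous_intros)
qed

text \<open>Meant for the smoothed maximum of tangents, where the slopes are gradients at good
  points. For the partition function the uniform slope bound grows with the system.\<close>

lemma
  assumes "\<And>a. a \<in> F \<Longrightarrow> (\<Sum>i\<in>I. (v a i)\<^sup>2) \<le> K"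
  shows integrable_L_square: "integrable (gaussian_vec I) (\<lambda>x. (L x)\<^sup>2)"
    and variance_L_le: "prob_space.variance (gaussian_vec I) L \<le> K"
proof -
  interpret prob_space "gaussian_vec I" by (rule prob_space_gaussian_vec)
  define B where "B = sqrt K"
  define A where "A = ln (card F) + (\<Sum>a\<in>F. \<bar>c a\<bar>)"
  have card: "card F \<ge> 1" using finite_F F_nonempty by (simp add: Suc_leI card_gt_0_iff)
  have grad_bound: "\<bar>grad i x\<bar> \<le> B" if "i \<in> I" for i x
  proof -
    have "(grad i x)\<^sup>2 \<le> grad_sq x"
      unfolding grad_sq_def using that finite_I by (intro member_le_sum) auto
    also have "\<dots> \<le> K" using assms by (rule grad_sq_le)
    finally show ?thesis unfolding B_def using real_le_rsqrt by (simp add: real_sqrt_abs[symmetric] del: real_sqrt_abs)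
  qed
  have v_bound: "\<bar>v a i\<bar> \<le> B" if "i \<in> I" "a \<in> F" for i a
  proof -
    have "(v a i)\<^sup>2 \<le> (\<Sum>i\<in>I. (v a i)\<^sup>2)"
      using that finite_I by (intro member_le_sum) auto
    also have "\<dots> \<le> K" using assms that by blast
    finally show ?thesis unfolding B_def by (simp add: real_sqrt_abs[symmetric] del: real_sqrt_abs)
  qed
  have growth: "\<bar>L x\<bar> \<le> A + B * (\<Sum>i\<in>I. \<bar>x i\<bar>)" for x
  proof -
    define R where "R = (\<Sum>a\<in>F. \<bar>c a\<bar>) + B * (\<Sum>i\<in>I. \<bar>x i\<bar>)"
    have lin: "\<bar>lin a x\<bar> \<le> R" if "a \<in> F" for a
    proof -
      have "\<bar>lin a x\<bar> \<le> \<bar>c a\<bar> + (\<Sum>i\<in>I. \<bar>v a i * x i\<bar>)"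
        unfolding lin_def by (intro order_trans[OF abs_triangle_ineq] add_left_mono sum_abs)
      also have "\<bar>c a\<bar> \<le> (\<Sum>a\<in>F. \<bar>c a\<bar>)"
        using that finite_F by (intro member_le_sum) auto
      also have "(\<Sum>i\<in>I. \<bar>v a i * x i\<bar>) \<le> B * (\<Sum>i\<in>I. \<bar>x i\<bar>)"
        unfolding sum_distrib_left abs_mult using v_bound that by (intro sum_mono mult_right_mono) auto
      finally show ?thesis by (simp add: R_def)
    qed
    have "Z x \<le> card F * exp R"
      unfolding Z_def using lin by (intro sum_bounded_above) (auto simp: abs_le_iff)
    hence "L x \<le> ln (card F * exp R)"
      unfolding L_def using Z_pos[of x] card by (intro ln_mono) auto
    hence upper: "L x \<le> ln (card F) + R" using card by (simp add: ln_mult)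
    obtain a where a: "a \<in> F" using F_nonempty by auto
    have "exp (- R) \<le> exp (lin a x)" using lin[OF a] by (simp add: abs_le_iff)
    also have "\<dots> \<le> Z x" unfolding Z_def using a finite_F by (intro member_le_sum) auto
    finally have "ln (exp (- R)) \<le> L x" unfolding L_def by (intro ln_mono) auto
    moreover have "0 \<le> ln (real (card F))" using card by simp
    ultimately show ?thesis using upper unfolding A_def R_def by (simp add: abs_le_iff)
  qed
  show "integrable (gaussian_vec I) (\<lambda>x. (L x)\<^sup>2)"
    by (rule integrable_square_linear_growth[OF finite_I _ growth]) simp
  have "variance L \<le> expectation grad_sq"
    unfolding grad_sq_def[abs_def]
    by (rule gaussian_poincare[OF finite_I _ _ has_real_derivative_L continuous_on_grad grad_bound growth]) auto
  also have "\<dots> \<le> expectation (\<lambda>_. K)"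
  proof (rule integral_mono)
    show "integrable (gaussian_vec I) grad_sq"
      using grad_sq_le[OF assms] grad_sq_nonneg
      by (intro integrable_const_bound[where B = K] AE_I2) auto
  qed (use grad_sq_le[OF assms] in auto)
  finally show "variance L \<le> K" by (simp add: prob_space)
qed

lemma
  shows integrable_exp_lin_add: "integrable (gaussian_vec I) (\<lambda>x. exp (lin a x + lin b x))"
    and integral_exp_lin_add: "(\<integral>x. exp (lin a x + lin b x) \<partial>gaussian_vec I)
      = exp (c a + c b + (\<Sum>i\<in>I. (v a i + v b i)\<^sup>2) / 2)"
proof -
  have eq: "exp (lin a x + lin b x) = exp (c a + c b) * exp (\<Sum>i\<in>I. (v a i + v b i) * x i)" for x
    by (simp add: lin_def mult_exp_exp sum.distrib ring_distribs)
  show "integrable (gaussian_vec I) (\<lambda>x. exp (lin a x + lin b x))"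
    unfolding eq using integrable_exp_gaussian_vec[OF finite_I] by simp
  show "(\<integral>x. exp (lin a x + lin b x) \<partial>gaussian_vec I)
      = exp (c a + c b + (\<Sum>i\<in>I. (v a i + v b i)\<^sup>2) / 2)"
    unfolding eq using integral_exp_gaussian_vec[OF finite_I, of "\<lambda>i. v a i + v b i"]
    by (simp add: exp_add)
qed

lemma
  shows integrable_exp_lin: "integrable (gaussian_vec I) (\<lambda>x. exp (lin a x))"
    and integral_exp_lin: "(\<integral>x. exp (lin a x) \<partial>gaussian_vec I) = exp (c a + (\<Sum>i\<in>I. (v a i)\<^sup>2) / 2)"
proof -
  have eq: "exp (lin a x) = exp (c a) * exp (\<Sum>i\<in>I. v a i * x i)" for x
    by (simp add: lin_def mult_exp_exp)
  show "integrable (gaussian_vec I) (\<lambda>x. exp (lin a x))"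
    unfolding eq using integrable_exp_gaussian_vec[OF finite_I] by simp
  show "(\<integral>x. exp (lin a x) \<partial>gaussian_vec I) = exp (c a + (\<Sum>i\<in>I. (v a i)\<^sup>2) / 2)"
    unfolding eq using integral_exp_gaussian_vec[OF finite_I, of "v a"]
    by (simp add: exp_add)
qed

section \<open>The lower tail through Lipschitz minorants\<close>

definition tangent :: "('i \<Rightarrow> real) \<Rightarrow> ('i \<Rightarrow> real) \<Rightarrow> real" where
  "tangent a x = L a + (\<Sum>i\<in>I. grad i a * (x i - a i))"

definition good :: "real \<Rightarrow> real \<Rightarrow> ('i \<Rightarrow> real) set" where
  "good s K = {x \<in> space (gaussian_vec I). - s \<le> L x \<and> grad_sq x \<le> K}"

lemma sets_good [measurable]: "good s K \<in> sets (gaussian_vec I)"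
  unfolding good_def by measurable

lemma open_tangent_greater: "open {x. r < tangent a x}"
proof -
  have "continuous_on UNIV (\<lambda>x :: 'i \<Rightarrow> real. x i)" for i
    by (rule continuous_on_product_coordinates)
  hence "continuous_on UNIV (tangent a)"
    unfolding tangent_def by (intro continuous_intros)
  thus ?thesis by (intro open_Collect_less continuous_intros)
qed

lemma measurable_tangent [measurable]: "tangent a \<in> borel_measurable (gaussian_vec I)"
  unfolding tangent_def by measurable

text \<open>Lindelof's theorem reduces the supremum of the tangents at all points of \<open>good s K\<close>
  to a finite family, at the price of a little probability.\<close>

lemma finite_tangent_family:
  assumes "0 < p" "p < measure (gaussian_vec I) (good s K)"
  obtains A where "finite A" "A \<noteq> {}" "A \<subseteq> good s K"
    "p < measure (gaussian_vec I) {x \<in> space (gaussian_vec I). \<exists>a\<in>A. - s - 1 < tangent a x}"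
proof -
  interpret prob_space "gaussian_vec I" by (rule prob_space_gaussian_vec)
  \<comment> \<open>The slack 1 makes the inequality strict, so each \<open>U a\<close> is open and
    every good point lies in its own set: \<open>tangent x x\<close> equals \<open>L x\<close>,
    which is at least -s.\<close>
  define U where "U a = {x. - s - 1 < tangent a x}" for a
  obtain \<F> where \<F>: "\<F> \<subseteq> U ` good s K" "countable \<F>" "\<Union>\<F> = \<Union>(U ` good s K)"
    by (rule Lindelof[of "U ` good s K"]) (auto simp: U_def open_tangent_greater)
  obtain A where A: "countable A" "A \<subseteq> good s K" "\<F> = U ` A"
    using countable_subset_image[of \<F> U "good s K"] \<F>(1,2) by blast
  have cover: "good s K \<subseteq> (\<Union>a\<in>A. U a)"
  proof
    fix x assume x: "x \<in> good s K"
    hence "x \<in> U x" by (auto simp: U_def tangent_def good_def)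
    thus "x \<in> (\<Union>a\<in>A. U a)" using x \<F>(3) A(3) by blast
  qed
  have "good s K \<noteq> {}" using assms by auto
  hence "A \<noteq> {}" using cover by auto
  define e where "e = from_nat_into A"
  have range_e: "range e = A" unfolding e_def using \<open>A \<noteq> {}\<close> A(1) by (rule range_from_nat_into)
  define D where "D m = {x \<in> space (gaussian_vec I). \<exists>a\<in>e ` {..<m}. - s - 1 < tangent a x}" for m :: nat
  have D: "D m \<in> sets (gaussian_vec I)" for m
    unfolding D_def by measurable
  \<comment> \<open>Continuity from below along the enumeration; since p is strictly below the
    limit, some finite stage already exceeds it.\<close>
  have "(\<lambda>m. prob (D m)) \<longlonglongrightarrow> prob (\<Union>m. D m)"
  proof (rule finite_Lim_measure_incseq)
    show "range D \<subseteq> sets (gaussian_vec I)" using D by auto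
    show "incseq D" unfolding incseq_def D_def by fastforce
  qed
  moreover have "good s K \<subseteq> (\<Union>m. D m)"
  proof
    fix x assume x: "x \<in> good s K"
    then obtain k where "x \<in> U (e k)" using cover range_e by blast
    hence "x \<in> D (Suc k)" using x by (auto simp: D_def U_def good_def)
    thus "x \<in> (\<Union>m. D m)" by blast
  qed
  hence "prob (good s K) \<le> prob (\<Union>m. D m)"
    by (rule finite_measure_mono) (use D in auto)
  hence "p < prob (\<Union>m. D m)" using assms by linarith
  ultimately have "\<forall>\<^sub>F m in sequentially. p < prob (D m)"
    by (rule order_tendstoD)
  then obtain m where m: "p < prob (D m)"
    by (auto simp: eventually_sequentially)
  show ?thesis
  proof (rule that[of "e ` {..<m}"])
    show "e ` {..<m} \<noteq> {}"
    proof
      assume "e ` {..<m} = {}"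
      hence "D m = {}" by (simp add: D_def)
      thus False using m assms by simp
    qed
    show "e ` {..<m} \<subseteq> good s K" using range_e A(2) by auto
    show "p < prob {x \<in> space (gaussian_vec I). \<exists>a\<in>e ` {..<m}. - s - 1 < tangent a x}"
      using m unfolding D_def .
  qed auto
qed

text \<open>The smoothed maximum of finitely many tangents is a minorant of \<open>L\<close> whose gradient is
  bounded everywhere.\<close>

lemma lipschitz_minorant:
  assumes "0 < p" "p < measure (gaussian_vec I) (good s K)"
  obtains \<Phi> where "\<Phi> \<in> borel_measurable (gaussian_vec I)"
    "integrable (gaussian_vec I) (\<lambda>x. (\<Phi> x)\<^sup>2)"
    "prob_space.variance (gaussian_vec I) \<Phi> \<le> K"
    "\<forall>x. \<Phi> x \<le> L x + 1"
    "p < measure (gaussian_vec I) {x \<in> space (gaussian_vec I). - s - 1 < \<Phi> x}"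
proof -
  interpret prob_space "gaussian_vec I" by (rule prob_space_gaussian_vec)
  obtain A where A: "finite A" "A \<noteq> {}" "A \<subseteq> good s K"
    "p < prob {x \<in> space (gaussian_vec I). \<exists>a\<in>A. - s - 1 < tangent a x}"
    using finite_tangent_family[OF assms] .
  \<comment> \<open>\<open>N\<close> acts as an inverse temperature: the log-sum-exp of
    \<open>N\<close> times the tangents, divided by \<open>N\<close>, exceeds their maximum by at
    most \<open>ln N / N\<close>, hence by less than 1 however large the family is. The factor
    \<open>N\<^sup>2\<close> in the squared slopes is cancelled by the rescaling in the
    variance.\<close>
  define N where "N = real (card A)"
  have N: "1 \<le> N" unfolding N_def using A(1,2) by (simp add: Suc_leI card_gt_0_iff)
  interpret T: log_sum_exp I A "\<lambda>a. N * (L a - (\<Sum>i\<in>I. grad i a * a i))" "\<lambda>a i. N * grad i a"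
    using finite_I A by unfold_locales auto
  have T_lin: "T.lin a x = N * tangent a x" for a x
    unfolding T.lin_def tangent_def by (simp add: sum_distrib_left algebra_simps sum_subtractf)
  define \<Phi> where "\<Phi> x = T.L x / N" for x
  have v: "(\<Sum>i\<in>I. (N * grad i a)\<^sup>2) \<le> N\<^sup>2 * K" if "a \<in> A" for a
  proof -
    have "(\<Sum>i\<in>I. (N * grad i a)\<^sup>2) = N\<^sup>2 * grad_sq a"
      by (simp add: grad_sq_def sum_distrib_left power_mult_distrib)
    thus ?thesis using A(3) that by (auto simp: good_def intro!: mult_left_mono)
  qed
  show ?thesis
  proof (rule that[of \<Phi>])
    show meas [measurable]: "\<Phi> \<in> borel_measurable (gaussian_vec I)"
      unfolding \<Phi>_def by measurable
    show "integrable (gaussian_vec I) (\<lambda>x. (\<Phi> x)\<^sup>2)"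
      unfolding \<Phi>_def power_divide using T.integrable_L_square[OF v] by simp
    have "variance \<Phi> = variance T.L / N\<^sup>2"
      unfolding \<Phi>_def by (simp add: diff_divide_distrib[symmetric] power_divide)
    also have "\<dots> \<le> N\<^sup>2 * K / N\<^sup>2"
      by (intro divide_right_mono T.variance_L_le v) auto
    finally show "variance \<Phi> \<le> K" using N by simp
    show "\<forall>x. \<Phi> x \<le> L x + 1"
    proof
      fix x
      have "T.Z x \<le> N * exp (N * L x)"
        using sum_bounded_above[of A "\<lambda>a. exp (N * tangent a x)" "exp (N * L x)"] L_ge_tangent N
        unfolding T.Z_def T_lin by (simp add: tangent_def N_def)
      hence "T.L x \<le> ln (N * exp (N * L x))"
        unfolding T.L_def using T.Z_pos[of x] N by (intro ln_mono) auto
      also have "\<dots> = ln N + N * L x" using N by (simp add: ln_mult)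
      also have "ln N \<le> N" using ln_le_minus_one[of N] N by simp
      finally have "T.L x \<le> (L x + 1) * N" by (simp add: algebra_simps)
      thus "\<Phi> x \<le> L x + 1" unfolding \<Phi>_def using N by (simp add: divide_le_eq)
    qed
    have "tangent a x \<le> \<Phi> x" if "a \<in> A" for a x
    proof -
      have "exp (N * tangent a x) \<le> T.Z x"
        unfolding T.Z_def T_lin using that A(1) by (intro member_le_sum) auto
      hence "ln (exp (N * tangent a x)) \<le> T.L x"
        unfolding T.L_def by (intro ln_mono) auto
      thus ?thesis unfolding \<Phi>_def using N by (simp add: le_divide_eq mult.commute)
    qed
    hence "{x \<in> space (gaussian_vec I). \<exists>a\<in>A. - s - 1 < tangent a x}
        \<subseteq> {x \<in> space (gaussian_vec I). - s - 1 < \<Phi> x}"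
      by (auto intro: less_le_trans)
    hence "prob {x \<in> space (gaussian_vec I). \<exists>a\<in>A. - s - 1 < tangent a x}
        \<le> prob {x \<in> space (gaussian_vec I). - s - 1 < \<Phi> x}"
      by (intro finite_measure_mono) measurable
    thus "p < prob {x \<in> space (gaussian_vec I). - s - 1 < \<Phi> x}" using A(4) by linarith
  qed
qed


text \<open>Where \<open>L\<close> is nonnegative it is at most \<open>Z\<close>. Where it is
  negative, the minorant bounds its modulus by the fluctuation of \<Phi> plus a constant, and the
  variance of \<Phi> is at most \<open>K\<close>.\<close>

lemma expectation_L_square_le:
  assumes p: "0 < p" "p < measure (gaussian_vec I) (good s K)" and s: "0 \<le> s"
    and int: "integrable (gaussian_vec I) (\<lambda>x. (Z x)\<^sup>2)"
  shows "integrable (gaussian_vec I) (\<lambda>x. (L x)\<^sup>2)"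
    and "(\<integral>x. (L x)\<^sup>2 \<partial>gaussian_vec I)
      \<le> (\<integral>x. (Z x)\<^sup>2 \<partial>gaussian_vec I) + 2 * K + 2 * (s + 2 + sqrt (K / p))\<^sup>2"
proof -
  interpret prob_space "gaussian_vec I" by (rule prob_space_gaussian_vec)
  obtain \<Phi> where meas [measurable]: "\<Phi> \<in> borel_measurable (gaussian_vec I)"
    and \<Phi>: "integrable (gaussian_vec I) (\<lambda>x. (\<Phi> x)\<^sup>2)" "variance \<Phi> \<le> K" "\<forall>x. \<Phi> x \<le> L x + 1"
    "p < prob {x \<in> space (gaussian_vec I). - s - 1 < \<Phi> x}"
    using lipschitz_minorant[OF p] .
  \<comment> \<open>The 2 collects one unit from the threshold \<open>- s - 1\<close> and one from
    the minorant lying below \<open>L x + 1\<close>; thus the mean of \<Phi> is at least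
    \<open>1 - T\<close>.\<close>
  define T where "T = s + 2 + sqrt (K / p)"
  have "0 \<le> K" using variance_positive[of \<Phi>] \<Phi>(2) by linarith
  hence T: "0 \<le> T" using s p by (simp add: T_def)
  have mean: "1 - T \<le> expectation \<Phi>"
    using expectation_ge_of_variance_le[OF meas \<Phi>(1,2) p(1) \<Phi>(4)] by (simp add: T_def)
  have \<Phi>1: "integrable (gaussian_vec I) \<Phi>"
    by (rule square_integrable_imp_integrable[OF meas \<Phi>(1)])
  have pointwise: "(L x)\<^sup>2 \<le> (Z x)\<^sup>2 + 2 * (\<Phi> x - expectation \<Phi>)\<^sup>2 + 2 * T\<^sup>2" for x
  proof (cases "0 \<le> L x")
    case True
    have "L x \<le> Z x" using ln_le_minus_one[OF Z_pos[of x]] by (simp add: L_def)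
    hence "(L x)\<^sup>2 \<le> (Z x)\<^sup>2" using True by (intro power_mono)
    thus ?thesis by (simp add: add_increasing2)
  next
    case False
    define d where "d = \<bar>\<Phi> x - expectation \<Phi>\<bar>"
    have "\<bar>L x\<bar> \<le> d + T" using False mean \<Phi>(3)[rule_format, of x] unfolding d_def by linarith
    hence "(L x)\<^sup>2 \<le> (d + T)\<^sup>2" using power_mono[of "\<bar>L x\<bar>" "d + T" 2] by simp
    also have "\<dots> \<le> 2 * d\<^sup>2 + 2 * T\<^sup>2"
      using zero_le_power2[of "d - T"] by (simp add: power2_eq_square algebra_simps)
    finally have "(L x)\<^sup>2 \<le> 2 * (\<Phi> x - expectation \<Phi>)\<^sup>2 + 2 * T\<^sup>2"
      by (simp add: d_def)
    thus ?thesis using zero_le_power2[of "Z x"] by linarith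
  qed
  have bound: "integrable (gaussian_vec I) (\<lambda>x. (Z x)\<^sup>2 + 2 * (\<Phi> x - expectation \<Phi>)\<^sup>2 + 2 * T\<^sup>2)"
    using int \<Phi>(1) \<Phi>1 by (simp add: power2_diff)
  show L2: "integrable (gaussian_vec I) (\<lambda>x. (L x)\<^sup>2)"
    by (rule Bochner_Integration.integrable_bound[OF bound])
      (use pointwise in \<open>auto intro: order_trans[OF _ abs_ge_self]\<close>)
  have "expectation (\<lambda>x. (L x)\<^sup>2)
      \<le> expectation (\<lambda>x. (Z x)\<^sup>2 + 2 * (\<Phi> x - expectation \<Phi>)\<^sup>2 + 2 * T\<^sup>2)"
    by (intro integral_mono L2 bound pointwise)
  also have "\<dots> = expectation (\<lambda>x. (Z x)\<^sup>2) + 2 * variance \<Phi> + 2 * T\<^sup>2"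
  proof -
    have "integrable (gaussian_vec I) (\<lambda>x. (\<Phi> x - expectation \<Phi>)\<^sup>2)"
      using \<Phi>(1) \<Phi>1 by (simp add: power2_diff)
    thus ?thesis using int by (simp add: prob_space)
  qed
  finally show "expectation (\<lambda>x. (L x)\<^sup>2) \<le> expectation (\<lambda>x. (Z x)\<^sup>2) + 2 * K + 2 * (s + 2 + sqrt (K / p))\<^sup>2"
    using \<Phi>(2) by (simp add: T_def)
qed

text \<open>A truncated second moment argument: the expectation of \<open>Z\<close> is carried neither by
  \<open>Z < 1 / 2\<close> nor by a large gradient.\<close>

lemma measure_good_ge:
  assumes Z1: "integrable (gaussian_vec I) Z" "(\<integral>x. Z x \<partial>gaussian_vec I) = 1"
    and Z2: "integrable (gaussian_vec I) (\<lambda>x. (Z x)\<^sup>2)" "(\<integral>x. (Z x)\<^sup>2 \<partial>gaussian_vec I) \<le> C"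
    and W: "integrable (gaussian_vec I) (\<lambda>x. (Z x)\<^sup>2 * grad_sq x)"
      "(\<integral>x. (Z x)\<^sup>2 * grad_sq x \<partial>gaussian_vec I) \<le> C"
    and C: "0 < C"
  shows "1 / (8 * C) \<le> measure (gaussian_vec I) (good (ln 2) (16 * C))"
proof -
  interpret prob_space "gaussian_vec I" by (rule prob_space_gaussian_vec)
  let ?G = "good (ln 2) (16 * C)"
  \<comment> \<open>A majorant of \<open>Z\<close> with one piece per case: 1/2 when
    \<open>Z\<close> is small; the gradient term when the gradient is large, as then
    \<open>Z x \<le> 2 * (Z x)\<^sup>2\<close>; and the last two terms on the good set, by the
    inequality of arithmetic and geometric means. Taking expectations gives 1 \<le> 1/2 + 1/8 + 1/8
    + 2 * C * prob.\<close>
  let ?b = "\<lambda>x. 1 / 2 + (Z x)\<^sup>2 * grad_sq x / (8 * C) + (Z x)\<^sup>2 / (8 * C) + 2 * C * indicator ?G x"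
  have b: "integrable (gaussian_vec I) ?b"
    using Z2 W by (simp add: integrable_indicator_iff emeasure_eq_measure)
  have pointwise: "Z x \<le> ?b x" if x: "x \<in> space (gaussian_vec I)" for x
  proof -
    consider "Z x < 1 / 2" | "1 / 2 \<le> Z x" "16 * C < grad_sq x" | "x \<in> ?G"
    proof -
      have "- ln 2 \<le> L x" if "1 / 2 \<le> Z x"
        using ln_mono[OF that] by (simp add: L_def ln_div)
      thus ?thesis using that x unfolding good_def by fastforce
    qed
    thus ?thesis
    proof cases
      case 1
      have "0 \<le> (Z x)\<^sup>2 * grad_sq x / (8 * C) + (Z x)\<^sup>2 / (8 * C) + 2 * C * indicator ?G x"
        using C grad_sq_nonneg[of x] by simp
      thus ?thesis using 1 by linarith
    next
      case 2
      have "Z x * 1 \<le> Z x * (2 * Z x)" using 2 by (intro mult_left_mono) auto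
      also have "\<dots> = (Z x)\<^sup>2 * (16 * C) / (8 * C)" using C by (simp add: power2_eq_square)
      also have "\<dots> \<le> (Z x)\<^sup>2 * grad_sq x / (8 * C)"
        using 2 C by (intro divide_right_mono mult_left_mono) auto
      finally show ?thesis using C by (simp add: add_increasing add_increasing2)
    next
      case 3
      have "0 \<le> (Z x - 4 * C)\<^sup>2 / (8 * C)" using C by simp
      also have "\<dots> = (Z x)\<^sup>2 / (8 * C) + 2 * C - Z x"
        using C by (simp add: power2_eq_square field_simps)
      finally have "Z x \<le> (Z x)\<^sup>2 / (8 * C) + 2 * C" by simp
      moreover have "0 \<le> (Z x)\<^sup>2 * grad_sq x / (8 * C)" using C grad_sq_nonneg[of x] by simp
      ultimately show ?thesis using 3 by simp
    qed
  qed
  have "1 \<le> expectation ?b"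
    using integral_mono[OF Z1(1) b pointwise] Z1(2) by simp
  also have "expectation ?b = 1 / 2 + expectation (\<lambda>x. (Z x)\<^sup>2 * grad_sq x) / (8 * C)
      + expectation (\<lambda>x. (Z x)\<^sup>2) / (8 * C) + 2 * C * prob ?G"
    using Z2 W by (simp add: integrable_indicator_iff emeasure_eq_measure prob_space)
  also have "\<dots> \<le> 1 / 2 + C / (8 * C) + C / (8 * C) + 2 * C * prob ?G"
    using Z2 W C by (intro add_mono divide_right_mono) auto
  also have "\<dots> = 3 / 4 + 2 * C * prob ?G" using C by simp
  finally show ?thesis using C by (simp add: field_simps)
qed

end

section \<open>The Sherrington-Kirkpatrick model at high temperature\<close>

text \<open>The bound cosh x \<le> exp(x^2 / 2), i.e. a random sign is sub-Gaussian. The derivative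
  of y^2 / 2 - ln (cosh y) is y - tanh y, which is nonnegative for y \<ge> 0 because sinh y \<le> y
  cosh y.\<close>

lemma exp_add_exp_minus_le: "exp x + exp (- x) \<le> 2 * exp (x\<^sup>2 / 2)" for x :: real
proof -
  have sinh_le: "sinh y \<le> y * cosh y" if "0 \<le> y" for y :: real
  proof -
    have "((\<lambda>y. y * cosh y - sinh y) has_real_derivative z * sinh z) (at z)" for z :: real
      by (auto intro!: derivative_eq_intros)
    hence "0 * cosh 0 - sinh 0 \<le> y * cosh y - sinh y"
      using that
      by (intro DERIV_nonneg_imp_nondecreasing[of 0 y "\<lambda>y. y * cosh y - sinh y"]) force+
    thus ?thesis by simp
  qed
  have "0 \<le> y\<^sup>2 / 2 - ln (cosh y)" if "0 \<le> y" for y :: real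
  proof -
    have "0\<^sup>2 / 2 - ln (cosh 0) \<le> y\<^sup>2 / 2 - ln (cosh y)"
    proof (rule DERIV_nonneg_imp_nondecreasing[of 0 y "\<lambda>y. y\<^sup>2 / 2 - ln (cosh y)", OF that])
      fix z :: real assume "0 \<le> z"
      have "((\<lambda>y. y\<^sup>2 / 2 - ln (cosh y)) has_real_derivative z - sinh z / cosh z) (at z)"
        by (auto intro!: derivative_eq_intros)
      moreover have "0 \<le> z - sinh z / cosh z"
        using sinh_le[OF \<open>0 \<le> z\<close>] by (simp add: field_simps)
      ultimately show "\<exists>D. ((\<lambda>y. y\<^sup>2 / 2 - ln (cosh y)) has_real_derivative D) (at z) \<and> 0 \<le> D"
        by blast
    qed
    thus ?thesis by simp
  qed
  from this[of "\<bar>x\<bar>"] have "ln (cosh x) \<le> x\<^sup>2 / 2" by simp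
  hence "exp (ln (cosh x)) \<le> exp (x\<^sup>2 / 2)" by (simp only: exp_le_cancel_iff)
  hence "cosh x \<le> exp (x\<^sup>2 / 2)" by simp
  thus ?thesis by (simp add: cosh_field_def)
qed

lemma finite_spin_configs: "finite (spin_configs n)"
  unfolding spin_configs_def by (intro finite_PiE) auto

lemma card_spin_configs: "card (spin_configs n) = 2 ^ n"
  unfolding spin_configs_def by (simp add: card_PiE numeral_2_eq_2)

text \<open>The sum factorises over sites. At each site the sign of \<tau> only exchanges the two
  summands, so every factor is 2 cosh s.\<close>

lemma sum_exp_spin_configs_le:
  assumes "\<tau> \<in> spin_configs n"
  shows "(\<Sum>\<sigma>\<in>spin_configs n. exp (s * (\<Sum>i=1..n. \<sigma> i * \<tau> i))) \<le> 2 ^ n * exp (n * s\<^sup>2 / 2)"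
proof -
  have "(\<Sum>\<sigma>\<in>spin_configs n. exp (s * (\<Sum>i=1..n. \<sigma> i * \<tau> i)))
      = (\<Sum>\<sigma>\<in>spin_configs n. \<Prod>i\<in>{1..n}. exp (s * (\<sigma> i * \<tau> i)))"
    by (simp add: sum_distrib_left exp_sum)
  also have "\<dots> = (\<Prod>i\<in>{1..n}. \<Sum>\<epsilon>\<in>{-1, 1}. exp (s * (\<epsilon> * \<tau> i)))"
    unfolding spin_configs_def by (subst prod_sum_PiE) auto
  also have "\<dots> \<le> (\<Prod>i\<in>{1..n}. 2 * exp (s\<^sup>2 / 2))"
  proof (intro prod_mono conjI)
    fix i assume "i \<in> {1..n}"
    hence "\<tau> i = -1 \<or> \<tau> i = 1"
      using assms unfolding spin_configs_def by blast
    hence "(s * \<tau> i)\<^sup>2 = s\<^sup>2" by auto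
    thus "(\<Sum>\<epsilon>\<in>{-1, 1}. exp (s * (\<epsilon> * \<tau> i))) \<le> 2 * exp (s\<^sup>2 / 2)"
      using exp_add_exp_minus_le[of "s * \<tau> i"] by simp
  qed (auto intro: sum_nonneg)
  also have "\<dots> = 2 ^ n * exp (n * s\<^sup>2 / 2)"
    by (simp add: power_mult_distrib exp_of_nat_mult[symmetric])
  finally show ?thesis .
qed

text \<open>The square in the exponent is linearised by an auxiliary Gaussian variable.\<close>

lemma sum_exp_square_overlap_le:
  assumes "0 \<le> t" "t < 1 / 2" "1 \<le> n"
  shows "(\<Sum>\<sigma>\<in>spin_configs n. \<Sum>\<tau>\<in>spin_configs n. exp (t * (\<Sum>i=1..n. \<sigma> i * \<tau> i)\<^sup>2 / n))
    \<le> 4 ^ n / sqrt (1 - 2 * t)"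
proof -
  \<comment> \<open>Chosen so that the Gaussian moment at \<open>u * m\<close> reproduces exp(t *
    m^2 / n).\<close>
  define u where "u = sqrt (2 * t / n)"
  have u: "u\<^sup>2 = 2 * t / n" using assms by (simp add: u_def)
  have row: "(\<Sum>\<sigma>\<in>spin_configs n. exp (t * (\<Sum>i=1..n. \<sigma> i * \<tau> i)\<^sup>2 / n)) \<le> 2 ^ n / sqrt (1 - 2 * t)"
    if "\<tau> \<in> spin_configs n" for \<tau>
  proof -
    define m where "m \<sigma> = (\<Sum>i=1..n. \<sigma> i * \<tau> i)" for \<sigma>
    have "exp (t * (m \<sigma>)\<^sup>2 / n) = (\<integral>g. exp ((u * m \<sigma>) * g) \<partial>std_gaussian)" for \<sigma>
      unfolding integral_exp_std_gaussian power_mult_distrib u by simp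
    hence "(\<Sum>\<sigma>\<in>spin_configs n. exp (t * (m \<sigma>)\<^sup>2 / n))
        = (\<integral>g. (\<Sum>\<sigma>\<in>spin_configs n. exp ((u * m \<sigma>) * g)) \<partial>std_gaussian)"
      by (simp add: integrable_exp_std_gaussian)
    \<comment> \<open>For fixed g the exponent is linear in the spins, so the sum factorises. The n
      sites, each contributing \<open>(u * g)\<^sup>2 / 2\<close>, add up to
      \<open>t * g\<^sup>2\<close>, in which n no longer appears.\<close>
    also have "\<dots> \<le> (\<integral>g. 2 ^ n * exp (t * g\<^sup>2) \<partial>std_gaussian)"
    proof (rule integral_mono)
      fix g :: real
      have "n * (u * g)\<^sup>2 / 2 = t * g\<^sup>2"
        using assms by (simp add: power_mult_distrib u)
      thus "(\<Sum>\<sigma>\<in>spin_configs n. exp ((u * m \<sigma>) * g)) \<le> 2 ^ n * exp (t * g\<^sup>2)"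
        using sum_exp_spin_configs_le[OF that, of "u * g"] by (simp add: m_def mult_ac)
    qed (use assms in \<open>auto intro: integrable_exp_std_gaussian integrable_exp_square_std_gaussian\<close>)
    also have "\<dots> = 2 ^ n / sqrt (1 - 2 * t)"
      using assms by (simp add: integral_exp_square_std_gaussian)
    finally show ?thesis by (simp add: m_def)
  qed
  have "(\<Sum>\<sigma>\<in>spin_configs n. \<Sum>\<tau>\<in>spin_configs n. exp (t * (\<Sum>i=1..n. \<sigma> i * \<tau> i)\<^sup>2 / n))
     = (\<Sum>\<tau>\<in>spin_configs n. \<Sum>\<sigma>\<in>spin_configs n. exp (t * (\<Sum>i=1..n. \<sigma> i * \<tau> i)\<^sup>2 / n))"
    by (rule sum.swap)
  also have "\<dots> \<le> (\<Sum>\<tau>\<in>spin_configs n. 2 ^ n / sqrt (1 - 2 * t))"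
    by (intro sum_mono row)
  also have "\<dots> = 4 ^ n / sqrt (1 - 2 * t)"
    by (simp add: card_spin_configs power_mult_distrib[symmetric])
  finally show ?thesis .
qed

section \<open>The law of the disorder\<close>

definition index_pairs :: "nat \<Rightarrow> (nat \<times> nat) set" where
  "index_pairs n = {1..n} \<times> {1..n}"

text \<open>Replaces the abstract probability space by the concrete product measure: independence
  makes the joint law the product of the marginals. \<open>1 \<le> n\<close> supplies the nonempty
  index set required by this characterisation of independence.\<close>

lemma distr_sk_disorder:
  assumes "sk_disorder M n X" "1 \<le> n"
  shows "(\<lambda>\<omega>. \<lambda>p\<in>index_pairs n. X (fst p) (snd p) \<omega>) \<in> M \<rightarrow>\<^sub>M gaussian_vec (index_pairs n)"
    and "distr M (gaussian_vec (index_pairs n)) (\<lambda>\<omega>. \<lambda>p\<in>index_pairs n. X (fst p) (snd p) \<omega>) = gaussian_vec (index_pairs n)"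
proof -
  interpret prob_space M using assms by (simp add: sk_disorder_def)
  have d: "distributed M lborel (X (fst p) (snd p)) std_normal_density" if "p \<in> index_pairs n" for p
    using assms that by (auto simp: sk_disorder_def index_pairs_def)
  have rv [measurable]: "X (fst p) (snd p) \<in> borel_measurable M" if "p \<in> index_pairs n" for p
    using distributed_measurable[OF d[OF that]] by simp
  have sets: "sets (gaussian_vec (index_pairs n)) = sets (PiM (index_pairs n) (\<lambda>_. borel))"
    by (rule sets_PiM_cong) auto
  show "(\<lambda>\<omega>. \<lambda>p\<in>index_pairs n. X (fst p) (snd p) \<omega>) \<in> M \<rightarrow>\<^sub>M gaussian_vec (index_pairs n)"
    by (rule measurable_restrict) (use rv in simp)
  have "indep_vars (\<lambda>_. borel) (\<lambda>p. X (fst p) (snd p)) (index_pairs n)"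
    using assms by (simp add: sk_disorder_def case_prod_unfold index_pairs_def)
  hence "distr M (PiM (index_pairs n) (\<lambda>_. borel)) (\<lambda>\<omega>. \<lambda>p\<in>index_pairs n. X (fst p) (snd p) \<omega>)
      = PiM (index_pairs n) (\<lambda>p. distr M borel (X (fst p) (snd p)))"
    using assms rv by (subst (asm) indep_vars_iff_distr_eq_PiM') (auto simp: index_pairs_def)
  also have "\<dots> = gaussian_vec (index_pairs n)"
  proof (rule PiM_cong)
    fix p assume "p \<in> index_pairs n"
    have "distr M borel (X (fst p) (snd p)) = distr M lborel (X (fst p) (snd p))"
      by (rule distr_cong) auto
    also have "\<dots> = std_gaussian"
      unfolding std_gaussian_def using d[OF \<open>p \<in> index_pairs n\<close>] by (rule distributed_distr_eq_density)
    finally show "distr M borel (X (fst p) (snd p)) = std_gaussian" .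
  qed simp
  also have "distr M (PiM (index_pairs n) (\<lambda>_. borel)) (\<lambda>\<omega>. \<lambda>p\<in>index_pairs n. X (fst p) (snd p) \<omega>)
      = distr M (gaussian_vec (index_pairs n)) (\<lambda>\<omega>. \<lambda>p\<in>index_pairs n. X (fst p) (snd p) \<omega>)"
    using sets by (intro distr_cong) auto
  finally show "distr M (gaussian_vec (index_pairs n)) (\<lambda>\<omega>. \<lambda>p\<in>index_pairs n. X (fst p) (snd p) \<omega>) = gaussian_vec (index_pairs n)" .
qed

text \<open>The summand \<open>const\<close> in the exponent normalises the partition function to expectation one.\<close>

locale sk_high_temperature =
  fixes n :: nat and \<beta> :: real
  assumes n: "1 \<le> n" and \<beta>: "0 < \<beta>" "\<beta> < 1 / 2"
begin

definition coeff :: "(nat \<Rightarrow> real) \<Rightarrow> nat \<times> nat \<Rightarrow> real" where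
  "coeff \<sigma> p = - (\<beta> / sqrt n) * (\<sigma> (fst p) * \<sigma> (snd p))"

definition const :: real where
  "const = - (n * ln 2) - \<beta>\<^sup>2 * n / 2"

sublocale log_sum_exp "index_pairs n" "spin_configs n" "\<lambda>_. const" coeff
proof
  show "spin_configs n \<noteq> {}" using card_spin_configs[of n] by fastforce
qed (auto simp: finite_spin_configs index_pairs_def)

definition overlap :: "(nat \<Rightarrow> real) \<Rightarrow> (nat \<Rightarrow> real) \<Rightarrow> real" where
  "overlap \<sigma> \<tau> = (\<Sum>i=1..n. \<sigma> i * \<tau> i)"

text \<open>This is the covariance of the two exponents. The indices run over a full square, so the
  double sum is the square of a single one.\<close>

lemma sum_coeff_mult:
  "(\<Sum>p\<in>index_pairs n. coeff \<sigma> p * coeff \<tau> p) = \<beta>\<^sup>2 * (overlap \<sigma> \<tau>)\<^sup>2 / n"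
proof -
  have "coeff \<sigma> p * coeff \<tau> p
      = (\<beta> / sqrt n)\<^sup>2 * (\<sigma> (fst p) * \<tau> (fst p) * (\<sigma> (snd p) * \<tau> (snd p)))" for p
    by (simp add: coeff_def power2_eq_square mult_ac)
  hence "(\<Sum>p\<in>index_pairs n. coeff \<sigma> p * coeff \<tau> p)
      = (\<beta> / sqrt n)\<^sup>2 * (\<Sum>i=1..n. \<Sum>j=1..n. \<sigma> i * \<tau> i * (\<sigma> j * \<tau> j))"
    by (simp add: index_pairs_def sum_distrib_left sum.cartesian_product case_prod_unfold)
  also have "\<dots> = (\<beta> / sqrt n)\<^sup>2 * (overlap \<sigma> \<tau>)\<^sup>2"
    by (simp add: overlap_def power2_eq_square sum_product)
  finally show ?thesis by (simp add: power_divide)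
qed

lemma overlap_self: "\<sigma> \<in> spin_configs n \<Longrightarrow> overlap \<sigma> \<sigma> = n"
proof -
  assume \<sigma>: "\<sigma> \<in> spin_configs n"
  have "\<sigma> i * \<sigma> i = 1" if "i \<in> {1..n}" for i
  proof -
    have "\<sigma> i = -1 \<or> \<sigma> i = 1" using \<sigma> that unfolding spin_configs_def by blast
    thus ?thesis by auto
  qed
  thus ?thesis by (simp add: overlap_def)
qed

lemma sum_coeff_square: "\<sigma> \<in> spin_configs n \<Longrightarrow> (\<Sum>p\<in>index_pairs n. (coeff \<sigma> p)\<^sup>2) = \<beta>\<^sup>2 * n"
  using sum_coeff_mult[of \<sigma> \<sigma>] n by (simp add: overlap_self power2_eq_square)

lemma exp_const: "exp const = exp (- (\<beta>\<^sup>2 * n / 2)) / 2 ^ n"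
proof -
  have "exp (real n * ln 2) = (2::real) ^ n" by (simp add: exp_of_nat_mult)
  moreover have "const = - (\<beta>\<^sup>2 * n / 2) - n * ln 2" by (simp add: const_def)
  ultimately show ?thesis by (simp only: exp_diff)
qed

section \<open>Moments of the normalised partition function\<close>

lemma expectation_exp_lin:
  "\<sigma> \<in> spin_configs n \<Longrightarrow> (\<integral>x. exp (lin \<sigma> x) \<partial>gaussian_vec (index_pairs n)) = 1 / 2 ^ n"
  by (simp add: integral_exp_lin sum_coeff_square exp_add exp_const exp_minus)

text \<open>The two variance contributions cancel against the normalisation, so only the covariance
  of the replicas survives in the exponent.\<close>

lemma expectation_exp_lin_add:
  assumes "\<sigma> \<in> spin_configs n" "\<tau> \<in> spin_configs n"
  shows "(\<integral>x. exp (lin \<sigma> x + lin \<tau> x) \<partial>gaussian_vec (index_pairs n))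
    = exp (\<beta>\<^sup>2 * (overlap \<sigma> \<tau>)\<^sup>2 / n) / 4 ^ n"
proof -
  have sq: "(\<Sum>p\<in>index_pairs n. (coeff \<sigma> p + coeff \<tau> p)\<^sup>2) / 2
      = \<beta>\<^sup>2 * n + \<beta>\<^sup>2 * (overlap \<sigma> \<tau>)\<^sup>2 / n"
    using assms
    by (simp add: power2_sum sum.distrib sum_coeff_square mult.assoc sum_distrib_left[symmetric] sum_coeff_mult)
  have "const + const + (\<Sum>p\<in>index_pairs n. (coeff \<sigma> p + coeff \<tau> p)\<^sup>2) / 2
      = \<beta>\<^sup>2 * (overlap \<sigma> \<tau>)\<^sup>2 / n - real (2 * n) * ln 2"
  proof -
    have "real (2 * n) * ln 2 = 2 * (real n * ln 2)" by simp
    thus ?thesis using sq unfolding const_def by linarith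
  qed
  moreover have "exp (real (2 * n) * ln 2) = (4::real) ^ n"
    by (simp only: exp_of_nat_mult power_mult) simp
  ultimately show ?thesis
    unfolding integral_exp_lin_add by (simp only: exp_diff)
qed

text \<open>The overlap bound \<open>1 / sqrt (1 - 2 * t)\<close> at
  \<open>t = 2 * \<beta>\<^sup>2\<close>.\<close>

definition C :: real where
  "C = 1 / sqrt (1 - 4 * \<beta>\<^sup>2)"

lemma beta_square: "4 * \<beta>\<^sup>2 < 1"
  using \<beta> power_strict_mono[of \<beta> "1 / 2" 2] by (simp add: power_divide)

lemma C_pos: "0 < C"
  using beta_square by (simp add: C_def)

text \<open>The factor 2 in the exponent leaves room for the gradient: one copy of the covariance
  comes from the second moment, the other absorbs the polynomial factor.\<close>

lemma sum_exp_overlap_le: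
  "(\<Sum>\<sigma>\<in>spin_configs n. \<Sum>\<tau>\<in>spin_configs n. exp (2 * (\<beta>\<^sup>2 * (overlap \<sigma> \<tau>)\<^sup>2 / n)) / 4 ^ n) \<le> C"
proof -
  have "(\<Sum>\<sigma>\<in>spin_configs n. \<Sum>\<tau>\<in>spin_configs n. exp (2 * (\<beta>\<^sup>2 * (overlap \<sigma> \<tau>)\<^sup>2 / n)) / 4 ^ n)
      = (\<Sum>\<sigma>\<in>spin_configs n. \<Sum>\<tau>\<in>spin_configs n. exp ((2 * \<beta>\<^sup>2) * (\<Sum>i=1..n. \<sigma> i * \<tau> i)\<^sup>2 / n)) / 4 ^ n"
    by (simp add: overlap_def sum_divide_distrib mult.assoc)
  also have "\<dots> \<le> 4 ^ n / sqrt (1 - 2 * (2 * \<beta>\<^sup>2)) / 4 ^ n"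
    using sum_exp_square_overlap_le[of "2 * \<beta>\<^sup>2" n] n beta_square by (intro divide_right_mono) auto
  also have "\<dots> = C" by (simp add: C_def)
  finally show ?thesis .
qed

lemma
  shows integrable_Z: "integrable (gaussian_vec (index_pairs n)) Z"
    and expectation_Z: "(\<integral>x. Z x \<partial>gaussian_vec (index_pairs n)) = 1"
proof -
  show "integrable (gaussian_vec (index_pairs n)) Z"
    unfolding Z_def[abs_def] by (intro Bochner_Integration.integrable_sum integrable_exp_lin)
  have "(\<integral>x. Z x \<partial>gaussian_vec (index_pairs n)) = (\<Sum>\<sigma>\<in>spin_configs n. 1 / 2 ^ n)"
    unfolding Z_def by (subst Bochner_Integration.integral_sum) (auto intro: integrable_exp_lin simp: expectation_exp_lin)
  thus "(\<integral>x. Z x \<partial>gaussian_vec (index_pairs n)) = 1" by (simp add: card_spin_configs)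
qed

lemma
  shows integrable_Z_square: "integrable (gaussian_vec (index_pairs n)) (\<lambda>x. (Z x)\<^sup>2)"
    and expectation_Z_square: "(\<integral>x. (Z x)\<^sup>2 \<partial>gaussian_vec (index_pairs n)) \<le> C"
proof -
  show "integrable (gaussian_vec (index_pairs n)) (\<lambda>x. (Z x)\<^sup>2)"
    unfolding Z_square by (intro Bochner_Integration.integrable_sum integrable_exp_lin_add)
  have "(\<integral>x. (Z x)\<^sup>2 \<partial>gaussian_vec (index_pairs n))
     = (\<Sum>\<sigma>\<in>spin_configs n. \<Sum>\<tau>\<in>spin_configs n. exp (\<beta>\<^sup>2 * (overlap \<sigma> \<tau>)\<^sup>2 / n) / 4 ^ n)"
    unfolding Z_square by (simp add: integrable_exp_lin_add expectation_exp_lin_add)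
  also have "\<dots> \<le> (\<Sum>\<sigma>\<in>spin_configs n. \<Sum>\<tau>\<in>spin_configs n. exp (2 * (\<beta>\<^sup>2 * (overlap \<sigma> \<tau>)\<^sup>2 / n)) / 4 ^ n)"
  proof (intro sum_mono divide_right_mono)
    fix \<sigma> \<tau>
    have "0 \<le> \<beta>\<^sup>2 * (overlap \<sigma> \<tau>)\<^sup>2 / n" by simp
    thus "exp (\<beta>\<^sup>2 * (overlap \<sigma> \<tau>)\<^sup>2 / n) \<le> exp (2 * (\<beta>\<^sup>2 * (overlap \<sigma> \<tau>)\<^sup>2 / n))"
      unfolding exp_le_cancel_iff by linarith
  qed simp
  finally show "(\<integral>x. (Z x)\<^sup>2 \<partial>gaussian_vec (index_pairs n)) \<le> C"
    using sum_exp_overlap_le by linarith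
qed

lemma
  shows integrable_Z_square_grad_sq:
      "integrable (gaussian_vec (index_pairs n)) (\<lambda>x. (Z x)\<^sup>2 * grad_sq x)"
    and expectation_Z_square_grad_sq:
      "(\<integral>x. (Z x)\<^sup>2 * grad_sq x \<partial>gaussian_vec (index_pairs n)) \<le> C"
proof -
  show "integrable (gaussian_vec (index_pairs n)) (\<lambda>x. (Z x)\<^sup>2 * grad_sq x)"
    unfolding Z_square_grad_sq
    by (intro Bochner_Integration.integrable_sum integrable_mult_left integrable_exp_lin_add)
  have "(\<integral>x. (Z x)\<^sup>2 * grad_sq x \<partial>gaussian_vec (index_pairs n))
     = (\<Sum>\<sigma>\<in>spin_configs n. \<Sum>\<tau>\<in>spin_configs n.
          exp (\<beta>\<^sup>2 * (overlap \<sigma> \<tau>)\<^sup>2 / n) / 4 ^ n * (\<beta>\<^sup>2 * (overlap \<sigma> \<tau>)\<^sup>2 / n))"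
    unfolding Z_square_grad_sq sum_coeff_mult by (simp add: integrable_exp_lin_add expectation_exp_lin_add)
  also have "\<dots> \<le> (\<Sum>\<sigma>\<in>spin_configs n. \<Sum>\<tau>\<in>spin_configs n. exp (2 * (\<beta>\<^sup>2 * (overlap \<sigma> \<tau>)\<^sup>2 / n)) / 4 ^ n)"
  proof (intro sum_mono)
    fix \<sigma> \<tau>
    define q where "q = \<beta>\<^sup>2 * (overlap \<sigma> \<tau>)\<^sup>2 / n"
    \<comment> \<open>The covariance factor produced by the gradient is paid for by doubling the
      exponent.\<close>
    have "q \<le> exp q" using exp_ge_add_one_self[of q] by linarith
    hence "exp q / 4 ^ n * q \<le> exp q / 4 ^ n * exp q" by (intro mult_left_mono) auto
    thus "exp q / 4 ^ n * q \<le> exp (2 * q) / 4 ^ n" by (simp add: mult_exp_exp)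
  qed
  finally show "(\<integral>x. (Z x)\<^sup>2 * grad_sq x \<partial>gaussian_vec (index_pairs n)) \<le> C"
    using sum_exp_overlap_le by linarith
qed

text \<open>Here \<open>s = ln 2\<close> and \<open>K = 16 * C\<close> are the parameters of the
  good set, and \<open>p = 1 / (16 * C)\<close> is half of its guaranteed measure, since a strict
  inequality is required. Hence \<open>sqrt (K / p)\<close> is again \<open>16 * C\<close>, and 33
  is 1 from the second moment of \<open>Z\<close> plus 2 * 16 from \<open>2 * K\<close>.\<close>

lemma
  shows integrable_L_square: "integrable (gaussian_vec (index_pairs n)) (\<lambda>x. (L x)\<^sup>2)"
    and expectation_L_square:
      "(\<integral>x. (L x)\<^sup>2 \<partial>gaussian_vec (index_pairs n)) \<le> 33 * C + 2 * (ln 2 + 2 + 16 * C)\<^sup>2"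
proof -
  have "1 / (16 * C) < 1 / (8 * C)" using C_pos by (simp add: field_simps)
  also have "\<dots> \<le> measure (gaussian_vec (index_pairs n)) (good (ln 2) (16 * C))"
    by (intro measure_good_ge integrable_Z expectation_Z integrable_Z_square expectation_Z_square
        integrable_Z_square_grad_sq expectation_Z_square_grad_sq C_pos)
  finally have p: "1 / (16 * C) < measure (gaussian_vec (index_pairs n)) (good (ln 2) (16 * C))" .
  have p0: "0 < 1 / (16 * C)" using C_pos by simp
  have "16 * C / (1 / (16 * C)) = (16 * C)\<^sup>2" by (simp add: power2_eq_square)
  hence sqrt: "sqrt (16 * C / (1 / (16 * C))) = 16 * C"
    using C_pos by (simp only: real_sqrt_abs)
  have s: "0 \<le> ln (2::real)" by simp
  show "integrable (gaussian_vec (index_pairs n)) (\<lambda>x. (L x)\<^sup>2)"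
    by (rule expectation_L_square_le(1)[OF p0 p s integrable_Z_square])
  show "(\<integral>x. (L x)\<^sup>2 \<partial>gaussian_vec (index_pairs n)) \<le> 33 * C + 2 * (ln 2 + 2 + 16 * C)\<^sup>2"
    using expectation_L_square_le(2)[OF p0 p s integrable_Z_square] expectation_Z_square
    unfolding sqrt by linarith
qed

section \<open>Transfer to the free energy\<close>

text \<open>The normalisation enters only as an additive shift, which the variance ignores, and the
  factor 1/\<beta> becomes the denominator \<open>\<beta>\<^sup>2\<close>.\<close>

lemma sk_free_energy_eq:
  "sk_free_energy n \<beta> (\<lambda>i j. y i j) = (L (\<lambda>p\<in>index_pairs n. y (fst p) (snd p)) - const) / \<beta>"
proof -
  let ?x = "\<lambda>p\<in>index_pairs n. y (fst p) (snd p)"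
  have lin: "lin \<sigma> ?x = const + \<beta> * sk_hamiltonian n y \<sigma>" for \<sigma>
  proof -
    have "(\<Sum>p\<in>index_pairs n. coeff \<sigma> p * ?x p)
        = (\<Sum>p\<in>index_pairs n. - (\<beta> / sqrt n) * (y (fst p) (snd p) * \<sigma> (fst p) * \<sigma> (snd p)))"
      by (intro sum.cong) (auto simp: coeff_def)
    also have "\<dots> = - (\<beta> / sqrt n) * (\<Sum>i=1..n. \<Sum>j=1..n. y i j * \<sigma> i * \<sigma> j)"
      by (simp only: index_pairs_def sum_distrib_left[symmetric] sum.cartesian_product case_prod_unfold)
    finally show ?thesis by (simp add: lin_def sk_hamiltonian_def)
  qed
  have "Z ?x = exp const * (\<Sum>\<sigma>\<in>spin_configs n. exp (\<beta> * sk_hamiltonian n y \<sigma>))"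
    unfolding Z_def lin by (simp add: exp_add sum_distrib_left)
  moreover have "0 < (\<Sum>\<sigma>\<in>spin_configs n. exp (\<beta> * sk_hamiltonian n y \<sigma>))"
    using finite_F F_nonempty by (intro sum_pos) auto
  ultimately have "L ?x = const + ln (\<Sum>\<sigma>\<in>spin_configs n. exp (\<beta> * sk_hamiltonian n y \<sigma>))"
    unfolding L_def by (simp add: ln_mult)
  thus ?thesis by (simp add: sk_free_energy_def)
qed

lemma
  assumes "sk_disorder M n X"
  shows integrable_sk_free_energy_square:
      "integrable M (\<lambda>\<omega>. (sk_free_energy n \<beta> (\<lambda>i j. X i j \<omega>))\<^sup>2)"
    and variance_sk_free_energy_le:
      "prob_space.variance M (\<lambda>\<omega>. sk_free_energy n \<beta> (\<lambda>i j. X i j \<omega>))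
        \<le> (33 * C + 2 * (ln 2 + 2 + 16 * C)\<^sup>2) / \<beta>\<^sup>2"
proof -
  interpret prob_space M using assms by (simp add: sk_disorder_def)
  define Y where "Y \<omega> = (\<lambda>p\<in>index_pairs n. X (fst p) (snd p) \<omega>)" for \<omega>
  have Y [measurable]: "Y \<in> M \<rightarrow>\<^sub>M gaussian_vec (index_pairs n)"
    and distr: "distr M (gaussian_vec (index_pairs n)) Y = gaussian_vec (index_pairs n)"
    unfolding Y_def using distr_sk_disorder[OF assms n] by simp_all
  have F: "sk_free_energy n \<beta> (\<lambda>i j. X i j \<omega>) = (L (Y \<omega>) - const) / \<beta>" for \<omega>
    unfolding Y_def by (rule sk_free_energy_eq)
  have L2: "integrable M (\<lambda>\<omega>. (L (Y \<omega>))\<^sup>2)"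
    using integrable_L_square by (subst (asm) distr[symmetric], subst (asm) integrable_distr_eq) auto
  have L1: "integrable M (\<lambda>\<omega>. L (Y \<omega>))"
    by (rule square_integrable_imp_integrable[OF _ L2]) simp
  show "integrable M (\<lambda>\<omega>. (sk_free_energy n \<beta> (\<lambda>i j. X i j \<omega>))\<^sup>2)"
    unfolding F power_divide power2_diff using L1 L2 by simp
  have "expectation (\<lambda>\<omega>. L (Y \<omega>) - const) = expectation (\<lambda>\<omega>. L (Y \<omega>)) - const"
    using L1 by (simp add: prob_space)
  hence "variance (\<lambda>\<omega>. sk_free_energy n \<beta> (\<lambda>i j. X i j \<omega>)) = variance (\<lambda>\<omega>. L (Y \<omega>)) / \<beta>\<^sup>2"
    unfolding F integral_divide_zero diff_divide_distrib[symmetric] power_divide by simp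
  also have "variance (\<lambda>\<omega>. L (Y \<omega>)) \<le> expectation (\<lambda>\<omega>. (L (Y \<omega>))\<^sup>2)"
    using L1 L2 by (simp add: variance_eq)
  also have "\<dots> = (\<integral>x. (L x)\<^sup>2 \<partial>gaussian_vec (index_pairs n))"
    by (subst distr[symmetric], subst integral_distr) auto
  also have "\<dots> \<le> 33 * C + 2 * (ln 2 + 2 + 16 * C)\<^sup>2"
    by (rule expectation_L_square)
  finally show "variance (\<lambda>\<omega>. sk_free_energy n \<beta> (\<lambda>i j. X i j \<omega>))
      \<le> (33 * C + 2 * (ln 2 + 2 + 16 * C)\<^sup>2) / \<beta>\<^sup>2"
    by (simp add: divide_right_mono)
qed

end

text \<open>Square integrability is part of the conclusion because the integral of a non-integrable
  function is 0 by default, so a bound on the formal variance alone would say little.\<close>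

theorem proposition1p1:
  fixes \<beta> :: real
  assumes "0 < \<beta>" and "\<beta> < 1 / 2"
  shows "\<exists>C>0. \<forall>n\<ge>1. \<forall>(M :: 'a measure) X. sk_disorder M n X \<longrightarrow>
           integrable M (\<lambda>\<omega>. (sk_free_energy n \<beta> (\<lambda>i j. X i j \<omega>))\<^sup>2) \<and>
           prob_space.variance M (\<lambda>\<omega>. sk_free_energy n \<beta> (\<lambda>i j. X i j \<omega>)) \<le> C / (2 * \<beta>\<^sup>2)"
proof -
  define K where "K = 1 / sqrt (1 - 4 * \<beta>\<^sup>2)"
  define B where "B = 33 * K + 2 * (ln 2 + 2 + 16 * K)\<^sup>2"
  have sk: "sk_high_temperature n \<beta>" if "1 \<le> n" for n
    using assms that by unfold_locales
  \<comment> \<open>Outside its locale this constant takes \<beta> as its only parameter, so the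
    bound is the same for all n; the instance n = 1 merely gives access to its equation.\<close>
  have K: "sk_high_temperature.C \<beta> = K"
    using sk_high_temperature.C_def[OF sk[OF order_refl]] by (simp add: K_def)
  have "0 < K" using sk_high_temperature.C_pos[OF sk[OF order_refl]] unfolding K .
  hence "0 < B" by (simp add: B_def add_pos_nonneg)
  show ?thesis
  \<comment> \<open>The factor 2 compensates the 2 in the denominator of the claim.\<close>
  proof (intro exI[of _ "2 * B"] conjI allI impI)
    fix n :: nat and M :: "'a measure" and X
    assume n: "1 \<le> n" and X: "sk_disorder M n X"
    show "integrable M (\<lambda>\<omega>. (sk_free_energy n \<beta> (\<lambda>i j. X i j \<omega>))\<^sup>2)"
      by (rule sk_high_temperature.integrable_sk_free_energy_square[OF sk[OF n] X])
    have "2 * B / (2 * \<beta>\<^sup>2) = B / \<beta>\<^sup>2" by simp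
    thus "prob_space.variance M (\<lambda>\<omega>. sk_free_energy n \<beta> (\<lambda>i j. X i j \<omega>)) \<le> 2 * B / (2 * \<beta>\<^sup>2)"
      using sk_high_temperature.variance_sk_free_energy_le[OF sk[OF n] X, unfolded K B_def[symmetric]]
      by (simp only:)
  next
    show "0 < 2 * B" using \<open>0 < B\<close> by simp
  qed
qed

end
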